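(* For $d=2$ and $p=2$ (cubic), or $d=1$ and $p=4$ (quintic), the focusing or defocusing ($\mu\in\{1,-1\}$) GP hierarchy $$i\partial_t\gamma^{(k)}+\Delta^{(k)}_\pm\gamma^{(k)}-\mu\,B_{k+\frac p2}\gamma^{(k+\frac p2)}=0,\qquad k\ge1,$$ is invariant under the pseudoconformal transformations $$\mathcal P\gamma^{(k)}(t,\underline x_k;\underline x_k')=\frac1{(1+bt)^{dk}}\,e^{-i\frac{b(|\underline x_k|^2-|\underline x_k'|^2)}{1+bt}}\;\gamma^{(k)}\Big(\frac1{1+bt},\frac{\underline x_k}{1+bt};\frac{\underline x_k'}{1+bt}\Big),$$ for $b\in\mathbb R\setminus\{0\}$. That is, for a solution $(\gamma^{(k)})_{k\in\mathbb N}$ of the hierarchy, $$i\partial_t\mathcal P\gamma^{(k)}+\Delta^{(k)}_\pm\mathcal P\gamma^{(k)}-\mu\,B_{k+\frac p2}\mathcal P\gamma^{(k+\frac p2)}=0$$ for all $k\ge1$.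
   Context: Notation: $\underline x_k=(x_1,\dots,x_k)$, $\underline x_k'=(x_1',\dots,x_k')$ with $x_j,x_j'\in\mathbb R^d$, $|\underline x_k|^2=\sum_{j}|x_j|^2$. Each $\gamma^{(k)}(t,\underline x_k;\underline x_k')$ is a (time-dependent) $k$-particle marginal density matrix ($\gamma^{(k)}\ge0$, $\mathrm{Tr}\,\gamma^{(k)}=1$), symmetric in the components of $\underline x_k$ and in those of $\underline x_k'$. $\Delta^{(k)}_\pm=\sum_{j=1}^k(\Delta_{x_j}-\Delta_{x_j'})$, and $$(B_{k+\frac p2}\gamma^{(k+\frac p2)})(t,\underline x_k;\underline x_k')=\sum_{j=1}^k\int dx_{k+1}\cdots dx_{k+\frac p2}\,dx_{k+1}'\cdots dx_{k+\frac p2}'\Big[\prod_{\ell=k+1}^{k+\frac p2}\delta(x_j-x_\ell)\delta(x_j-x_\ell')-\prod_{\ell=k+1}^{k+\frac p2}\delta(x_j'-x_\ell)\delta(x_j'-x_\ell')\Big]\gamma^{(k+\frac p2)}(t,\underline x_{k+\frac p2};\underline x_{k+\frac p2}').$$ The hierarchy is defocusing for $\mu=1$ and focusing for $\mu=-1$.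
   Formalization: The printed transformation does not preserve the hierarchy; the time argument 1/(1+bt) is corrected to t/(1+bt) and the phase -b(|x|²-|x'|²)/(1+bt) to +b(|x|²-|x'|²)/(4(1+bt)); solutions are taken in the classical sense, at times t with 1+bt ≠ 0. *)

theory Defs
  imports "HOL-Probability.Probability"
begin

text \<open>
  The number of particles varies inside the hierarchy, so a configuration
  \<open>x\<^sub>1, \<dots>, x\<^sub>k\<close> in \<open>\<real>\<^sup>d\<close> is a function on \<^typ>\<open>nat\<close> of which only the values at
  \<open>1, \<dots>, k\<close> matter (see \<open>kernel_of\<close>); \<open>d\<close> is \<open>CARD('d)\<close>.  A family of marginals
  \<open>\<gamma>\<close> is applied as \<open>\<gamma> k t x x'\<close>.
\<close>

type_synonym 'd config = "nat \<Rightarrow> real ^ 'd"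
type_synonym 'd kernel = "'d config \<Rightarrow> 'd config \<Rightarrow> complex"

definition kernel_of :: "nat \<Rightarrow> ('d::finite) kernel \<Rightarrow> bool" where
  "kernel_of k K \<longleftrightarrow>
     (\<forall>x y x' y'. (\<forall>j\<in>{1..k}. x j = y j \<and> x' j = y' j) \<longrightarrow> K x x' = K y y')"

subsection \<open>Density matrices\<close>

definition config_measure :: "nat \<Rightarrow> ('d::finite) config measure" where
  "config_measure k = (\<Pi>\<^sub>M j\<in>{1..k}. lborel)"

definition square_integrable :: "nat \<Rightarrow> (('d::finite) config \<Rightarrow> complex) \<Rightarrow> bool" where
  "square_integrable k f \<longleftrightarrow> f \<in> borel_measurable (config_measure k) \<and>
     integrable (config_measure k) (\<lambda>x. (cmod (f x))\<^sup>2)"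

definition positive_kernel :: "nat \<Rightarrow> ('d::finite) kernel \<Rightarrow> bool" where
  "positive_kernel k K \<longleftrightarrow> (\<forall>f. square_integrable k f \<longrightarrow>
     (LINT x|config_measure k. LINT x'|config_measure k. cnj (f x) * K x x' * f x')
       \<in> \<real>\<^sub>\<ge>\<^sub>0)"

text \<open>
  The trace is the integral of the kernel over the diagonal.  It is only used for
  continuous positive kernels, for which it is the operator trace.
\<close>

definition has_kernel_trace :: "nat \<Rightarrow> ('d::finite) kernel \<Rightarrow> complex \<Rightarrow> bool" where
  "has_kernel_trace k K c \<longleftrightarrow>
     has_bochner_integral (config_measure k) (\<lambda>x. K x x) c"

definition symmetric_kernel :: "nat \<Rightarrow> ('d::finite) kernel \<Rightarrow> bool" where
  "symmetric_kernel k K \<longleftrightarrow>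
     (\<forall>\<sigma> \<tau> x x'. \<sigma> permutes {1..k} \<and> \<tau> permutes {1..k} \<longrightarrow>
        K (x \<circ> \<sigma>) (x' \<circ> \<tau>) = K x x')"

definition marginal_density_matrix :: "nat \<Rightarrow> ('d::finite) kernel \<Rightarrow> bool" where
  "marginal_density_matrix k K \<longleftrightarrow>
     positive_kernel k K \<and> has_kernel_trace k K 1 \<and> symmetric_kernel k K"

subsection \<open>Derivatives\<close>

definition shift :: "nat \<Rightarrow> 'd::finite \<Rightarrow> real \<Rightarrow> 'd config \<Rightarrow> 'd config" where
  "shift j a h x = x(j := x j + h *\<^sub>R axis a 1)"

definition has_partial :: "nat \<Rightarrow> 'd::finite \<Rightarrow> ('d config \<Rightarrow> complex) \<Rightarrow> 'd config \<Rightarrow> bool" where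
  "has_partial j a F x \<longleftrightarrow> (\<lambda>h. F (shift j a h x)) differentiable (at 0)"

definition partial :: "nat \<Rightarrow> 'd::finite \<Rightarrow> ('d config \<Rightarrow> complex) \<Rightarrow> 'd config \<Rightarrow> complex" where
  "partial j a F x = vector_derivative (\<lambda>h. F (shift j a h x)) (at 0)"

definition particle_laplacian :: "nat \<Rightarrow> (('d::finite) config \<Rightarrow> complex) \<Rightarrow> 'd config \<Rightarrow> complex" where
  "particle_laplacian j F x = (\<Sum>a\<in>UNIV. partial j a (partial j a F) x)"

definition laplacian_pm :: "nat \<Rightarrow> ('d::finite) kernel \<Rightarrow> 'd kernel" where
  "laplacian_pm k K x x' =
     (\<Sum>j=1..k. particle_laplacian j (\<lambda>y. K y x') x - particle_laplacian j (\<lambda>y'. K x y') x')"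

subsection \<open>The interaction operator\<close>

text \<open>
  The factor \<open>\<Prod>\<^sub>l \<delta>(a - x\<^sub>l) dx\<^sub>l\<close>, with \<open>l\<close> running over \<open>J\<close>, is the product over \<open>J\<close> of
  the point masses at \<open>a\<close>.
\<close>

definition delta_measure :: "nat set \<Rightarrow> real ^ 'd \<Rightarrow> ('d::finite) config measure" where
  "delta_measure J a = (\<Pi>\<^sub>M l\<in>J. return borel a)"

definition delta_contraction ::
    "nat \<Rightarrow> nat \<Rightarrow> real ^ 'd \<Rightarrow> ('d::finite) kernel \<Rightarrow> 'd kernel" where
  "delta_contraction k q a K x x' =
     (LINT y|delta_measure {k+1..k+q} a. LINT y'|delta_measure {k+1..k+q} a.
        K (merge {1..k} {k+1..k+q} (x, y)) (merge {1..k} {k+1..k+q} (x', y')))"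

definition gp_interaction :: "nat \<Rightarrow> nat \<Rightarrow> ('d::finite) kernel \<Rightarrow> 'd kernel" where
  "gp_interaction p k K x x' =
     (\<Sum>j=1..k. delta_contraction k (p div 2) (x j) K x x'
               - delta_contraction k (p div 2) (x' j) K x x')"

subsection \<open>Solutions of the hierarchy\<close>

text \<open>
  Solutions are classical: \<open>C\<^sup>1\<close> in \<open>(t, x, x')\<close>, and the second derivatives that enter
  the Laplacians exist and are continuous.  Continuity on configurations is with respect
  to the product topology, which for functions of the first \<open>k\<close> components is ordinary
  continuity on \<open>(\<real>\<^sup>d)\<^sup>k\<close>.
\<close>

definition jointly_continuous :: "real set \<Rightarrow> (real \<Rightarrow> ('d::finite) kernel) \<Rightarrow> bool" where
  "jointly_continuous T g \<longleftrightarrow> continuous_on (T \<times> UNIV \<times> UNIV) (\<lambda>(t, x, x'). g t x x')"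

definition time_regular :: "real set \<Rightarrow> (real \<Rightarrow> ('d::finite) kernel) \<Rightarrow> bool" where
  "time_regular T g \<longleftrightarrow>
     (\<forall>t\<in>T. \<forall>x x'. (\<lambda>s. g s x x') differentiable (at t)) \<and>
     jointly_continuous T (\<lambda>t x x'. vector_derivative (\<lambda>s. g s x x') (at t))"

definition space_regular :: "nat \<Rightarrow> real set \<Rightarrow> (real \<Rightarrow> ('d::finite) kernel) \<Rightarrow> bool" where
  "space_regular k T g \<longleftrightarrow> (\<forall>j\<in>{1..k}. \<forall>a.
     (\<forall>t\<in>T. \<forall>x x'. has_partial j a (\<lambda>y. g t y x') x \<and>
                    has_partial j a (partial j a (\<lambda>y. g t y x')) x) \<and>
     jointly_continuous T (\<lambda>t x x'. partial j a (\<lambda>y. g t y x') x) \<and>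
     jointly_continuous T (\<lambda>t x x'. partial j a (partial j a (\<lambda>y. g t y x')) x))"

definition regular_kernel :: "nat \<Rightarrow> real set \<Rightarrow> (real \<Rightarrow> ('d::finite) kernel) \<Rightarrow> bool" where
  "regular_kernel k T g \<longleftrightarrow>
     (\<forall>t\<in>T. kernel_of k (g t)) \<and> jointly_continuous T g \<and> time_regular T g \<and>
     space_regular k T g \<and> space_regular k T (\<lambda>t x x'. g t x' x)"

definition gp_solution ::
    "nat \<Rightarrow> real \<Rightarrow> real set \<Rightarrow> (nat \<Rightarrow> real \<Rightarrow> ('d::finite) kernel) \<Rightarrow> bool" where
  "gp_solution p \<mu> T \<gamma> \<longleftrightarrow> (\<forall>k\<ge>1. regular_kernel k T (\<gamma> k) \<and>
     (\<forall>t\<in>T. \<forall>x x'.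
        \<i> * vector_derivative (\<lambda>s. \<gamma> k s x x') (at t)
        + laplacian_pm k (\<gamma> k t) x x'
        - of_real \<mu> * gp_interaction p k (\<gamma> (k + p div 2) t) x x' = 0))"

subsection \<open>The pseudoconformal transformation\<close>

definition config_norm_sq :: "nat \<Rightarrow> ('d::finite) config \<Rightarrow> real" where
  "config_norm_sq k x = (\<Sum>j=1..k. (norm (x j))\<^sup>2)"

text \<open>
  For \<open>i \<partial>\<^sub>t + \<Delta>\<close> and the rescaling \<open>x/(1 + bt)\<close>, the time argument has to have derivative
  \<open>(1 + bt)\<^sup>-\<^sup>2\<close> and the phase has to be \<open>b |x|\<^sup>2 / (4 (1 + bt))\<close>, the latter so that the
  first-order terms in \<open>x \<cdot> \<nabla>\<close> cancel.  The variant with time argument \<open>1/(1 + bt)\<close> and phase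
  \<open>- b |x|\<^sup>2 / (1 + bt)\<close>, which is also found in print, does not preserve the hierarchy:
  applied to the constant solution \<open>\<gamma> k = 1\<close> of the equations it leaves, for every
  \<open>b \<noteq> 0\<close>, a nonzero residual.
\<close>

definition pseudoconformal ::
    "real \<Rightarrow> (nat \<Rightarrow> real \<Rightarrow> ('d::finite) kernel) \<Rightarrow> nat \<Rightarrow> real \<Rightarrow> 'd kernel" where
  "pseudoconformal b \<gamma> k t x x' =
     of_real (1 / (1 + b * t) ^ (CARD('d) * k)) *
     exp (\<i> * of_real (b * (config_norm_sq k x - config_norm_sq k x') / (4 * (1 + b * t)))) *
     \<gamma> k (t / (1 + b * t)) (\<lambda>j. x j /\<^sub>R (1 + b * t)) (\<lambda>j. x' j /\<^sub>R (1 + b * t))"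

end

theory Submission
  imports Defs
begin

text \<open>
  With \<open>r = 1/(1 + bt)\<close> and \<open>\<theta> = tr\<close> one has \<open>r' = - b r\<^sup>2\<close> and \<open>\<theta>' = r\<^sup>2\<close>.  Differentiating the
  transformed kernel in \<open>t\<close> and twice in \<open>x, x'\<close>, the terms in \<open>|x|\<^sup>2\<close>, the radial derivatives
  \<open>x \<cdot> \<nabla>\<close> and the derivative of the amplitude \<open>r\<^sup>d\<^sup>k\<close> cancel, and what is left is \<open>r\<^sup>2\<close> times the
  linear part of the equation for \<open>\<gamma>\<close>.  In the interaction term the phases of the contracted
  particles cancel and the additional amplitude is \<open>r\<close> to the power \<open>d p / 2 = 2\<close>, which is the same factor.
  The time derivative along the moving point \<open>(\<theta>, r x, r x')\<close> needs the chain rule for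
  \<open>C\<^sup>1\<close> functions of finitely many coordinates; it is obtained from the two-variable one by
  adding one coordinate at a time.
\<close>

section \<open>Chain rule in two variables\<close>

text \<open>One partial derivative at the point itself and the other one existing nearby and
  continuous already give total differentiability. The asymmetry is what permits adding coordinates
  one at a time: \<open>A\<close> may come from an earlier application at a single point, and only
  the newly added variable has to satisfy the stronger condition.\<close>

lemma has_vector_derivative_two_variables:
  fixes f :: "real \<Rightarrow> real \<Rightarrow> complex"
  assumes fx: "((\<lambda>x. f x (v t)) has_vector_derivative A) (at (u t))"
    and fy: "\<And>x y. y \<in> Y \<Longrightarrow> ((\<lambda>y. f x y) has_vector_derivative B x y) (at y)"
    and cont: "continuous_on (UNIV \<times> Y) (\<lambda>(x, y). B x y)"
    and Y: "open Y" "v t \<in> Y"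
    and u: "(u has_vector_derivative u') (at t)"
    and v: "(v has_vector_derivative v') (at t)"
  shows "((\<lambda>s. f (u s) (v s)) has_vector_derivative u' *\<^sub>R A + v' *\<^sub>R B (u t) (v t)) (at t)"
proof -
  \<comment> \<open>\<open>has_derivative_partialsI\<close> asks for a convex domain in the second
    variable, so \<open>Y\<close> is shrunk to a ball.\<close>
  obtain e where e: "e > 0" "ball (v t) e \<subseteq> Y"
    using Y openE by blast
  let ?Y = "ball (v t) e"
  have op: "open (UNIV \<times> ?Y :: (real \<times> real) set)" and mem: "(u t, v t) \<in> UNIV \<times> ?Y"
    using e by (auto intro: open_Times)
  have "continuous_on (UNIV \<times> ?Y) (\<lambda>(x, y). B x y)"
    using cont by (rule continuous_on_subset) (use e in auto)
  then have "isCont (\<lambda>(x, y). B x y) (u t, v t)"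
    using continuous_on_eq_continuous_at[OF op] mem by blast
  \<comment> \<open>The partial derivative has to be continuous as a bounded linear map, hence the
    passage from the vector \<open>B x y\<close> to the operator
    \<open>h \<mapsto> h *\<^sub>R B x y\<close>.\<close>
  then have "continuous (at (u t, v t) within UNIV \<times> ?Y) (\<lambda>z. blinfun_scaleR_left (case z of (x, y) \<Rightarrow> B x y))"
    by (intro bounded_linear.continuous[OF bounded_linear_blinfun_scaleR_left])
      (rule continuous_at_imp_continuous_at_within)
  then have c: "continuous (at (u t, v t) within UNIV \<times> ?Y) (\<lambda>(x, y). blinfun_scaleR_left (B x y))"
    by (simp add: case_prod_beta')
  have "((\<lambda>(x, y). f x y) has_derivative
      (\<lambda>(tx, ty). tx *\<^sub>R A + blinfun_apply (blinfun_scaleR_left (B (u t) (v t))) ty))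
      (at (u t, v t) within UNIV \<times> ?Y)"
  proof (rule has_derivative_partialsI[where fy = "\<lambda>x y. blinfun_scaleR_left (B x y)", OF _ _ c])
    show "((\<lambda>x. f x (v t)) has_derivative (\<lambda>tx. tx *\<^sub>R A)) (at (u t) within UNIV)"
      using fx by (simp add: has_vector_derivative_def)
    show "((\<lambda>y. f x y) has_derivative blinfun_apply (blinfun_scaleR_left (B x y))) (at y within ?Y)"
      if "y \<in> ?Y" for x y
    proof -
      have "((\<lambda>y. f x y) has_vector_derivative B x y) (at y)" using fy e that by blast
      moreover have "blinfun_apply (blinfun_scaleR_left (B x y)) = (\<lambda>h. h *\<^sub>R B x y)"
        by (rule ext) simp
      ultimately show ?thesis
        by (simp add: has_vector_derivative_def has_derivative_at_withinI)
    qed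
  qed (use e in auto)
  then have D: "((\<lambda>(x, y). f x y) has_derivative (\<lambda>(tx, ty). tx *\<^sub>R A + ty *\<^sub>R B (u t) (v t)))
      (at (u t, v t))"
    using at_within_open[OF mem op] by simp
  have "((\<lambda>s. (u s, v s)) has_derivative (\<lambda>h. (h *\<^sub>R u', h *\<^sub>R v'))) (at t)"
    using u v unfolding has_vector_derivative_def by (rule has_derivative_Pair)
  from has_derivative_compose[OF this D] show ?thesis
    by (simp add: has_vector_derivative_def scaleR_add_right mult.commute)
qed

section \<open>Derivatives along coordinate lines and directions\<close>

lemma has_vector_derivative_at_translate:
  fixes f :: "real \<Rightarrow> 'a::real_normed_vector"
  assumes "((\<lambda>u. f (h + u)) has_vector_derivative D) (at 0)"
  shows "(f has_vector_derivative D) (at h)"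
proof -
  have "((\<lambda>u. u - h) has_vector_derivative 1) (at h)"
    by (auto intro!: derivative_eq_intros)
  then have "(((\<lambda>u. f (h + u)) \<circ> (\<lambda>u. u - h)) has_vector_derivative 1 *\<^sub>R D) (at h)"
    using assms by (intro vector_diff_chain_at) auto
  then show ?thesis
    by (simp add: o_def)
qed

lemma shift_0 [simp]: "shift j a 0 x = x"
  by (simp add: shift_def)

lemma shift_shift: "shift j a h (shift j a h' x) = shift j a (h' + h) x"
  by (simp add: shift_def scaleR_add_left add.assoc)

lemma has_partial_iff:
  "has_partial j a F x \<longleftrightarrow> ((\<lambda>h. F (shift j a h x)) has_vector_derivative partial j a F x) (at 0)"
  unfolding has_partial_def partial_def
  using vector_derivative_works by blast

lemma partialI:
  assumes "((\<lambda>h. F (shift j a h x)) has_vector_derivative D) (at 0)"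
  shows "has_partial j a F x" "partial j a F x = D"
  using assms unfolding has_partial_def partial_def
  by (auto intro: differentiableI_vector vector_derivative_at)

text \<open>\<open>partial\<close> differentiates at parameter 0 only. Shifts in one coordinate add
  up, so recentring at \<open>shift j a h x\<close> moves the derivative to any point of the
  coordinate line.\<close>

lemma has_vector_derivative_shift:
  assumes "has_partial j a F (shift j a h x)"
  shows "((\<lambda>h. F (shift j a h x)) has_vector_derivative partial j a F (shift j a h x)) (at h)"
proof -
  have "((\<lambda>u. F (shift j a u (shift j a h x))) has_vector_derivative
      partial j a F (shift j a h x)) (at 0)"
    using assms by (simp add: has_partial_iff)
  then have "((\<lambda>u. F (shift j a (h + u) x)) has_vector_derivative
      partial j a F (shift j a h x)) (at 0)"
    by (simp only: shift_shift)
  then show ?thesis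
    by (rule has_vector_derivative_at_translate)
qed

lemma continuous_on_config:
  fixes f :: "'a::topological_space \<Rightarrow> ('d::finite) config"
  assumes "\<And>j. continuous_on S (\<lambda>z. f z j)"
  shows "continuous_on S f"
  using assms by (rule continuous_on_coordinatewise_then_product)

lemma continuous_on_config_apply:
  fixes f :: "'a::topological_space \<Rightarrow> ('d::finite) config"
  assumes "continuous_on S f"
  shows "continuous_on S (\<lambda>z. f z j)"
  using assms by (rule continuous_on_product_then_coordinatewise)

lemma continuous_on_shift:
  assumes "continuous_on S f" "continuous_on S h"
  shows "continuous_on S (\<lambda>z. shift j a (h z) (f z))"
  unfolding shift_def
proof (rule continuous_on_config)
  fix i show "continuous_on S (\<lambda>z. ((f z)(j := f z j + h z *\<^sub>R axis a 1)) i)"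
    using continuous_on_config_apply[OF assms(1), of i] assms(2)
    by (cases "i = j") (simp_all add: continuous_on_add continuous_on_scaleR)
qed

text \<open>Induction on the set \<open>S\<close> of coordinates in which \<open>v\<close> may be
  nonzero. The induction hypothesis moves along the direction without one coordinate, and the
  two-variable rule adds the motion in that coordinate.\<close>

lemma has_vector_derivative_direction:
  fixes F :: "('d::finite) config \<Rightarrow> complex"
  assumes "finite S"
    and "\<And>j a x. (j, a) \<in> S \<Longrightarrow> has_partial j a F x"
    and "\<And>j a. (j, a) \<in> S \<Longrightarrow> continuous_on UNIV (partial j a F)"
    and "\<And>j a. (j, a) \<notin> S \<Longrightarrow> v j $ a = 0"
  shows "((\<lambda>h. F (\<lambda>j. x j + h *\<^sub>R v j)) has_vector_derivative
           (\<Sum>(j, a)\<in>S. (v j $ a) *\<^sub>R partial j a F x)) (at 0)"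
  using assms
proof (induction S arbitrary: v)
  case empty
  then have "v = (\<lambda>j. 0)" by (auto simp: vec_eq_iff)
  then show ?case by simp
next
  case (insert z S)
  obtain j a where z: "z = (j, a)" by fastforce
  \<comment> \<open>The direction \<open>v\<close> with its \<open>(j, a)\<close> component removed,
    so that it is supported in \<open>S\<close>.\<close>
  define v' where "v' = v(j := v j - (v j $ a) *\<^sub>R axis a 1)"
  have v'0: "v' j $ a = 0" by (simp add: v'_def)
  have v'': "v' i $ c = v i $ c" if "(i, c) \<noteq> (j, a)" for i c
    using that by (auto simp: v'_def axis_def)
  have IH: "((\<lambda>h. F (\<lambda>j. x j + h *\<^sub>R v' j)) has_vector_derivative
      (\<Sum>(j, a)\<in>S. (v' j $ a) *\<^sub>R partial j a F x)) (at 0)"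
  proof (rule insert.IH)
    show "v' i $ c = 0" if "(i, c) \<notin> S" for i c
      using that insert.prems(3)[of i c] v'0 v''[of i c] z by (cases "(i, c) = (j, a)") auto
  qed (use insert.prems in auto)
  have eq: "(\<Sum>(j, a)\<in>S. (v' j $ a) *\<^sub>R partial j a F x) = (\<Sum>(j, a)\<in>S. (v j $ a) *\<^sub>R partial j a F x)"
  proof (intro sum.cong refl, clarify)
    fix i c assume "(i, c) \<in> S"
    then have "(i, c) \<noteq> (j, a)" using insert.hyps z by metis
    then show "(v' i $ c) *\<^sub>R partial i c F x = (v i $ c) *\<^sub>R partial i c F x"
      using v'' by metis
  qed
  have "((\<lambda>h. F (shift j a (h * (v j $ a)) (\<lambda>i. x i + h *\<^sub>R v' i))) has_vector_derivative
     1 *\<^sub>R (\<Sum>(j, a)\<in>S. (v' j $ a) *\<^sub>R partial j a F x)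
     + (v j $ a) *\<^sub>R partial j a F (shift j a (0 * (v j $ a)) (\<lambda>i. x i + 0 *\<^sub>R v' i))) (at 0)"
  \<comment> \<open>The time \<open>h\<close> is split in two: \<open>h\<close> moves along
    \<open>v'\<close>, where only the derivative at 0 is known, and \<open>w\<close> moves
    coordinate \<open>(j, a)\<close>, where the derivative is known and continuous everywhere. The
    curve is \<open>w = h * (v j $ a)\<close>.\<close>
  proof (rule has_vector_derivative_two_variables
      [where f = "\<lambda>h w. F (shift j a w (\<lambda>i. x i + h *\<^sub>R v' i))" and Y = UNIV
         and B = "\<lambda>h w. partial j a F (shift j a w (\<lambda>i. x i + h *\<^sub>R v' i))" and u = "\<lambda>h. h"])
    show "((\<lambda>y. F (shift j a y (\<lambda>i. x i + h *\<^sub>R v' i))) has_vector_derivative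
        partial j a F (shift j a w (\<lambda>i. x i + h *\<^sub>R v' i))) (at w)" for h w
      using insert.prems(1) z by (intro has_vector_derivative_shift) auto
    have "continuous_on UNIV (partial j a F)" using insert.prems(2) z by auto
    then show "continuous_on (UNIV \<times> UNIV) (\<lambda>(h, w). partial j a F (shift j a w (\<lambda>i. x i + h *\<^sub>R v' i)))"
      unfolding case_prod_beta
      by (rule continuous_on_compose2)
        (intro continuous_on_shift continuous_on_config continuous_intros subset_UNIV)+
  qed (use IH in \<open>auto intro!: derivative_eq_intros\<close>)
  moreover have "shift j a (h * (v j $ a)) (\<lambda>i. x i + h *\<^sub>R v' i) = (\<lambda>i. x i + h *\<^sub>R v i)" for h
    by (rule ext) (simp add: shift_def v'_def scaleR_diff_right)
  moreover have "(\<Sum>(j, a)\<in>insert z S. (v j $ a) *\<^sub>R partial j a F x) =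
      (\<Sum>(j, a)\<in>S. (v j $ a) *\<^sub>R partial j a F x) + (v j $ a) *\<^sub>R partial j a F x"
    using insert.hyps by (simp add: z)
  ultimately show ?case
    by (simp only: eq mult_zero_left shift_0 scaleR_zero_left scaleR_one add_0_right)
qed

section \<open>Dilations and the Euler operator\<close>

definition rescale :: "real \<Rightarrow> ('d::finite) config \<Rightarrow> 'd config" where
  "rescale r x = (\<lambda>j. r *\<^sub>R x j)"

lemma rescale_apply [simp]: "rescale r x j = r *\<^sub>R x j"
  by (simp add: rescale_def)

lemma rescale_shift: "rescale r (shift j a h x) = shift j a (r * h) (rescale r x)"
  by (auto simp: rescale_def shift_def scaleR_add_right)

lemma continuous_on_rescale:
  assumes "continuous_on S r" "continuous_on S f"
  shows "continuous_on S (\<lambda>z. rescale (r z) (f z))"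
proof (rule continuous_on_config)
  fix j show "continuous_on S (\<lambda>z. rescale (r z) (f z) j)"
    using assms(1) continuous_on_config_apply[OF assms(2), of j]
    by (simp add: continuous_on_scaleR)
qed

text \<open>The Euler operator \<open>x \<bullet> \<nabla>\<close> in the first \<open>k\<close>
  particles. It arises twice with opposite effect: from the moving dilation in time and from the
  cross terms of the phase in space.\<close>

definition radial :: "nat \<Rightarrow> (('d::finite) config \<Rightarrow> complex) \<Rightarrow> 'd config \<Rightarrow> complex" where
  "radial k F x = (\<Sum>j=1..k. \<Sum>a\<in>UNIV. of_real (x j $ a) * partial j a F x)"

lemma has_vector_derivative_rescale:
  fixes F :: "('d::finite) config \<Rightarrow> complex"
  assumes dep: "\<And>x y. (\<And>j. j \<in> {1..k} \<Longrightarrow> x j = y j) \<Longrightarrow> F x = F y"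
    and part: "\<And>j a x. j \<in> {1..k} \<Longrightarrow> has_partial j a F x"
    and cont: "\<And>j a. j \<in> {1..k} \<Longrightarrow> continuous_on UNIV (partial j a F)"
  shows "((\<lambda>r. F (rescale r x)) has_vector_derivative
           (\<Sum>j=1..k. \<Sum>a\<in>UNIV. of_real (x j $ a) * partial j a F (rescale r x))) (at r)"
proof (rule has_vector_derivative_at_translate)
  \<comment> \<open>A configuration may be nonzero at infinitely many indices, whereas the chain
    rule needs finitely many coordinates. Truncating to \<open>1..k\<close> is harmless, since
    \<open>F\<close> depends on these particles only.\<close>
  define v where "v = (\<lambda>j. if j \<in> {1..k} then x j else 0)"
  have "((\<lambda>h. F (\<lambda>j. rescale r x j + h *\<^sub>R v j)) has_vector_derivative
      (\<Sum>(j, a)\<in>{1..k} \<times> UNIV. (v j $ a) *\<^sub>R partial j a F (rescale r x))) (at 0)"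
    by (rule has_vector_derivative_direction) (use part cont in \<open>auto simp: v_def\<close>)
  moreover have "F (\<lambda>j. rescale r x j + h *\<^sub>R v j) = F (rescale (r + h) x)" for h
    by (rule dep) (simp add: v_def scaleR_add_left)
  moreover have "(\<Sum>(j, a)\<in>{1..k} \<times> UNIV. (v j $ a) *\<^sub>R partial j a F (rescale r x)) =
      (\<Sum>j=1..k. \<Sum>a\<in>UNIV. of_real (x j $ a) * partial j a F (rescale r x))"
    unfolding sum.cartesian_product[symmetric]
    by (intro sum.cong) (auto simp: v_def scaleR_conv_of_real)
  ultimately show "((\<lambda>h. F (rescale (r + h) x)) has_vector_derivative
      (\<Sum>j=1..k. \<Sum>a\<in>UNIV. of_real (x j $ a) * partial j a F (rescale r x))) (at 0)"
    by simp
qed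

text \<open>The coordinates of the dilated point contribute one factor \<open>r\<close>. This turns
  the coefficient \<open>- b * r\<^sup>2\<close> of the moving frame into \<open>- b * r\<close> in
  front of \<open>radial\<close>, without dividing by \<open>r\<close>.\<close>

lemma radial_rescale:
  "radial k F (rescale r x) =
     of_real r * (\<Sum>j=1..k. \<Sum>a\<in>UNIV. of_real (x j $ a) * partial j a F (rescale r x))"
  by (simp add: radial_def sum_distrib_left mult.assoc)

section \<open>Continuity rules for families of kernels\<close>

lemma jointly_continuousD:
  fixes g :: "real \<Rightarrow> ('d::finite) kernel"
  assumes "jointly_continuous T g"
    and "continuous_on S t" "continuous_on S f" "continuous_on S f'"
    and "\<And>z. z \<in> S \<Longrightarrow> t z \<in> T"
  shows "continuous_on S (\<lambda>z. g (t z) (f z) (f' z))"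
proof -
  have "continuous_on S (\<lambda>z. (\<lambda>(t, x, x'). g t x x') (t z, f z, f' z))"
    using assms(1)[unfolded jointly_continuous_def]
    by (rule continuous_on_compose2) (use assms in \<open>auto intro!: continuous_on_Pair\<close>)
  then show ?thesis by simp
qed

lemma jointly_continuous_iff:
  "jointly_continuous T g \<longleftrightarrow>
     continuous_on (T \<times> UNIV \<times> UNIV) (\<lambda>z. g (fst z) (fst (snd z)) (snd (snd z)))"
  by (simp add: jointly_continuous_def case_prod_beta')

lemma jointly_continuous_add:
  "jointly_continuous T f \<Longrightarrow> jointly_continuous T g \<Longrightarrow>
     jointly_continuous T (\<lambda>t x x'. f t x x' + g t x x')"
  unfolding jointly_continuous_iff by (rule continuous_on_add)

lemma jointly_continuous_mult:
  "jointly_continuous T f \<Longrightarrow> jointly_continuous T g \<Longrightarrow>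
     jointly_continuous T (\<lambda>t x x'. f t x x' * g t x x')"
  unfolding jointly_continuous_iff by (rule continuous_on_mult)

lemma jointly_continuous_sum:
  "(\<And>i. i \<in> I \<Longrightarrow> jointly_continuous T (f i)) \<Longrightarrow>
     jointly_continuous T (\<lambda>t x x'. \<Sum>i\<in>I. f i t x x')"
  unfolding jointly_continuous_iff by (rule continuous_on_sum)

lemma jointly_continuous_time:
  assumes "continuous_on T f"
  shows "jointly_continuous T (\<lambda>t x x'. f t)"
  unfolding jointly_continuous_iff
  by (rule continuous_on_compose2[OF assms]) (auto intro: continuous_on_fst)

lemma jointly_continuous_swap:
  assumes "jointly_continuous T g"
  shows "jointly_continuous T (\<lambda>t x x'. g t x' x)"
  unfolding jointly_continuous_iff
  by (rule jointly_continuousD[OF assms]) (auto intro!: continuous_on_fst continuous_on_snd)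

lemma jointly_continuous_component:
  fixes a :: "'d::finite"
  shows "jointly_continuous T (\<lambda>t x x'. of_real (x j $ a))"
proof -
  have "continuous_on (T \<times> UNIV \<times> UNIV)
      (\<lambda>z :: real \<times> 'd config \<times> 'd config. fst (snd z) j)"
    by (intro continuous_on_config_apply continuous_on_fst continuous_on_snd continuous_on_id)
  then show ?thesis
    unfolding jointly_continuous_iff by (intro continuous_intros)
qed

section \<open>The squared norm and the quadratic phase\<close>

lemma continuous_on_config_norm_sq:
  assumes "continuous_on S f"
  shows "continuous_on S (\<lambda>z. config_norm_sq k (f z))"
  unfolding config_norm_sq_def
  using continuous_on_config_apply[OF assms] by (intro continuous_intros) auto

lemma config_norm_sq_rescale: "config_norm_sq k (rescale r x) = r\<^sup>2 * config_norm_sq k x"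
  by (simp add: config_norm_sq_def power_mult_distrib sum_distrib_left)

lemma norm_sq_eq_sum: "(norm (v :: real ^ 'd::finite))\<^sup>2 = (\<Sum>a\<in>UNIV. (v $ a)\<^sup>2)"
  by (simp only: power2_norm_eq_inner inner_vec_def) (simp add: power2_eq_square)

lemma config_norm_sq_shift:
  assumes "j \<in> {1..k}"
  shows "config_norm_sq k (shift j a h x) = config_norm_sq k x + 2 * h * (x j $ a) + h\<^sup>2"
proof -
  have "(norm (x j + h *\<^sub>R axis a 1))\<^sup>2 = (norm (x j))\<^sup>2 + 2 * h * (x j $ a) + h\<^sup>2"
    unfolding power2_norm_eq_inner
    by (simp add: inner_add_left inner_add_right inner_axis inner_axis' algebra_simps power2_eq_square)
  moreover have "(\<Sum>i\<in>{1..k} - {j}. (norm (shift j a h x i))\<^sup>2) = (\<Sum>i\<in>{1..k} - {j}. (norm (x i))\<^sup>2)"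
    by (intro sum.cong) (auto simp: shift_def)
  ultimately show ?thesis
    unfolding config_norm_sq_def sum.remove[OF finite_atLeastAtMost assms]
    by (simp add: shift_def)
qed

lemma has_vector_derivative_exp_phase:
  assumes "(p has_real_derivative p') (at t)"
  shows "((\<lambda>s. exp (\<i> * of_real (p s))) has_vector_derivative
           \<i> * of_real p' * exp (\<i> * of_real (p t))) (at t)"
proof -
  have "((\<lambda>s. \<i> * of_real (p s)) has_vector_derivative \<i> * of_real p') (at t)"
    using assms
    by (intro has_vector_derivative_mult_right has_vector_derivative_of_real)
      (simp add: has_real_derivative_iff_has_vector_derivative)
  then have "((exp \<circ> (\<lambda>s. \<i> * of_real (p s))) has_vector_derivative
      (\<i> * of_real p') * exp (\<i> * of_real (p t))) (at t)"
    by (rule field_vector_diff_chain_at) (rule DERIV_exp)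
  then show ?thesis by (simp add: o_def)
qed

section \<open>The transform at a fixed time and its spatial derivatives\<close>

text \<open>The transformation with time frozen, in terms of \<open>r = 1 / (1 + b * t)\<close>. The
  phase coefficient \<open>c\<close> is a separate parameter because the primed variables see the
  opposite phase: both \<open>c = b\<close> and \<open>c = - b\<close> are used.\<close>

definition lens :: "real \<Rightarrow> nat \<Rightarrow> real \<Rightarrow> ('d::finite) kernel \<Rightarrow> 'd kernel" where
  "lens c k r K x x' =
     of_real (r ^ (CARD('d) * k)) *
     exp (\<i> * of_real (c * r * (config_norm_sq k x - config_norm_sq k x') / 4)) *
     K (rescale r x) (rescale r x')"

lemma pseudoconformal_eq_lens:
  "pseudoconformal b \<gamma> k t =
     lens b k (inverse (1 + b * t)) (\<gamma> k (t * inverse (1 + b * t)))"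
proof (intro ext)
  fix x x' :: "'a config"
  have "1 / (1 + b * t) ^ n = inverse (1 + b * t) ^ n" for n
    by (simp add: power_one_over inverse_eq_divide)
  moreover have "b * N / (4 * (1 + b * t)) = b * inverse (1 + b * t) * N / 4" for N
    by (simp add: field_simps)
  ultimately show "pseudoconformal b \<gamma> k t x x' =
      lens b k (inverse (1 + b * t)) (\<gamma> k (t * inverse (1 + b * t))) x x'"
    unfolding pseudoconformal_def lens_def rescale_def by (simp only: divide_inverse[of t])
qed

text \<open>The phase is odd under exchanging \<open>x\<close> and \<open>x'\<close>. Every
  statement on the unprimed variables therefore gives one on the primed variables, with
  \<open>c\<close> replaced by \<open>- c\<close>.\<close>

lemma lens_swap: "lens c k r K x' x = lens (- c) k r (\<lambda>y y'. K y' y) x x'"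
proof -
  have "c * r * (N' - N) / 4 = - c * r * (N - N') / 4" for N N' :: real
    by (simp add: algebra_simps)
  then show ?thesis by (simp only: lens_def)
qed

lemma lens_sum: "lens c k r (\<lambda>y y'. \<Sum>i\<in>I. K i y y') x x' = (\<Sum>i\<in>I. lens c k r (K i) x x')"
  by (simp add: lens_def sum_distrib_left)

lemma kernel_of_lens:
  assumes "kernel_of k K"
  shows "kernel_of k (lens c k r K)"
  unfolding kernel_of_def
proof (intro allI impI)
  fix x y x' y' :: "'a config"
  assume *: "\<forall>j\<in>{1..k}. x j = y j \<and> x' j = y' j"
  then have "config_norm_sq k x = config_norm_sq k y" "config_norm_sq k x' = config_norm_sq k y'"
    by (auto simp: config_norm_sq_def)
  moreover have "K (rescale r x) (rescale r x') = K (rescale r y) (rescale r y')"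
    using assms * by (auto simp: kernel_of_def)
  ultimately show "lens c k r K x x' = lens c k r K y y'"
    by (simp add: lens_def)
qed

text \<open>
  Conjugation by the quadratic phase and the rescaling turns \<open>\<partial>\<^sub>j\<^sub>,\<^sub>a\<close> into this operator.
\<close>

definition covariant_partial :: "real \<Rightarrow> real \<Rightarrow> nat \<Rightarrow> 'd::finite \<Rightarrow> 'd kernel \<Rightarrow> 'd kernel" where
  "covariant_partial c r j a K y y' =
     (\<i> * of_real c / 2) * (of_real (y j $ a) * K y y') + of_real r * partial j a (\<lambda>z. K z y') y"

text \<open>Shifting by \<open>h\<close> adds
  \<open>c * r * (2 * h * (x j $ a) + h\<^sup>2) / 4\<close> to the phase, with derivative
  \<open>(c / 2) * (r * (x j $ a))\<close> at 0. The factor \<open>r\<close> is absorbed by the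
  coordinate of the dilated point, at which \<open>covariant_partial\<close> is evaluated; the inner
  dilation supplies its other coefficient \<open>r\<close>.\<close>

lemma has_vector_derivative_lens_shift:
  assumes j: "j \<in> {1..k}"
    and K: "has_partial j a (\<lambda>y. K y (rescale r x')) (rescale r x)"
  shows "((\<lambda>h. lens c k r K (shift j a h x) x') has_vector_derivative
           lens c k r (covariant_partial c r j a K) x x') (at 0)"
proof -
  let ?N = "config_norm_sq k x - config_norm_sq k x'"
  let ?A = "of_real (r ^ (CARD('a) * k)) :: complex"
  let ?p = "\<lambda>h. c * r * (config_norm_sq k x + 2 * h * (x j $ a) + h\<^sup>2 - config_norm_sq k x') / 4"
  let ?K = "K (rescale r x) (rescale r x')"
  let ?D = "partial j a (\<lambda>y. K y (rescale r x')) (rescale r x)"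
  have "(?p has_real_derivative c * r * (x j $ a) / 2) (at 0)"
    by (auto intro!: derivative_eq_intros)
  then have e: "((\<lambda>h. exp (\<i> * of_real (?p h))) has_vector_derivative
      \<i> * of_real (c * r * (x j $ a) / 2) * exp (\<i> * of_real (?p 0))) (at 0)"
    by (rule has_vector_derivative_exp_phase)
  have "((\<lambda>h. r * h) has_vector_derivative r) (at 0)"
    by (auto intro!: derivative_eq_intros)
  then have "(((\<lambda>h. K (shift j a h (rescale r x)) (rescale r x')) \<circ> (\<lambda>h. r * h))
      has_vector_derivative r *\<^sub>R ?D) (at 0)"
    using K by (intro vector_diff_chain_at) (auto simp: has_partial_iff)
  then have d: "((\<lambda>h. K (shift j a (r * h) (rescale r x)) (rescale r x'))
      has_vector_derivative r *\<^sub>R ?D) (at 0)"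
    by (simp add: o_def)
  have "((\<lambda>h. ?A * (exp (\<i> * of_real (?p h)) * K (shift j a (r * h) (rescale r x)) (rescale r x')))
      has_vector_derivative ?A * (exp (\<i> * of_real (?p 0)) * (r *\<^sub>R ?D) +
        \<i> * of_real (c * r * (x j $ a) / 2) * exp (\<i> * of_real (?p 0)) * ?K)) (at 0)"
    using has_vector_derivative_mult_right[OF has_vector_derivative_mult[OF e d], of ?A] by simp
  moreover have "?A * (exp (\<i> * of_real (?p 0)) * (r *\<^sub>R ?D) +
        \<i> * of_real (c * r * (x j $ a) / 2) * exp (\<i> * of_real (?p 0)) * ?K)
      = lens c k r (covariant_partial c r j a K) x x'"
    unfolding scaleR_conv_of_real[of r ?D] by (simp add: lens_def covariant_partial_def algebra_simps)
  moreover have "lens c k r K (shift j a h x) x' =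
      ?A * (exp (\<i> * of_real (?p h)) * K (shift j a (r * h) (rescale r x)) (rescale r x'))" for h
    unfolding lens_def rescale_shift config_norm_sq_shift[OF j] by (simp only: mult.assoc)
  ultimately show ?thesis by simp
qed

lemma has_vector_derivative_covariant_partial_shift:
  assumes "\<And>y. has_partial j a (\<lambda>z. K z y') y"
    and "has_partial j a (partial j a (\<lambda>z. K z y')) y"
  shows "((\<lambda>h. covariant_partial c r j a K (shift j a h y) y') has_vector_derivative
           (\<i> * of_real c / 2) * (K y y' + of_real (y j $ a) * partial j a (\<lambda>z. K z y') y)
           + of_real r * partial j a (partial j a (\<lambda>z. K z y')) y) (at 0)"
proof -
  have "((\<lambda>h. (y j $ a) + h) has_vector_derivative 1) (at 0)"
    by (auto intro!: derivative_eq_intros)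
  then have "((\<lambda>h. of_real ((y j $ a) + h) :: complex) has_vector_derivative 1) (at 0)"
    using has_vector_derivative_of_real[of "\<lambda>h. (y j $ a) + h" 1]
    by (simp add: has_real_derivative_iff_has_vector_derivative)
  moreover have "((\<lambda>h. K (shift j a h y) y') has_vector_derivative partial j a (\<lambda>z. K z y') y) (at 0)"
    using assms(1) by (simp add: has_partial_iff)
  ultimately have "((\<lambda>h. of_real ((y j $ a) + h) * K (shift j a h y) y') has_vector_derivative
      of_real (y j $ a + 0) * partial j a (\<lambda>z. K z y') y + 1 * K (shift j a 0 y) y') (at 0)"
    by (rule has_vector_derivative_mult)
  moreover have "((\<lambda>h. partial j a (\<lambda>z. K z y') (shift j a h y)) has_vector_derivative
      partial j a (partial j a (\<lambda>z. K z y')) y) (at 0)"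
    using assms(2) by (simp add: has_partial_iff)
  ultimately have "((\<lambda>h. (\<i> * of_real c / 2) * (of_real ((y j $ a) + h) * K (shift j a h y) y')
        + of_real r * partial j a (\<lambda>z. K z y') (shift j a h y)) has_vector_derivative
      (\<i> * of_real c / 2) * (of_real (y j $ a + 0) * partial j a (\<lambda>z. K z y') y + 1 * K (shift j a 0 y) y')
        + of_real r * partial j a (partial j a (\<lambda>z. K z y')) y) (at 0)"
    by (intro has_vector_derivative_add has_vector_derivative_mult_right)
  moreover have "(shift j a h y) j $ a = y j $ a + h" for h
    by (simp add: shift_def)
  ultimately show ?thesis
    by (simp add: covariant_partial_def add.commute)
qed

text \<open>This is the square of the operator \<open>(\<i> * c / 2) * y + r * \<partial>\<close>.
  The two cross terms differ by the commutator of \<open>\<partial>\<close> with multiplication by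
  \<open>y\<close>, which leaves the zeroth-order term \<open>\<i> * c * r / 2\<close>.\<close>

lemma covariant_partial_twice:
  assumes "\<And>y. has_partial j a (\<lambda>z. K z y') y"
    and "has_partial j a (partial j a (\<lambda>z. K z y')) y"
  shows "covariant_partial c r j a (covariant_partial c r j a K) y y' =
     - of_real (c\<^sup>2 / 4 * (y j $ a)\<^sup>2) * K y y'
     + \<i> * of_real (c * r) * (of_real (y j $ a) * partial j a (\<lambda>z. K z y') y)
     + \<i> * of_real (c * r) / 2 * K y y'
     + of_real (r\<^sup>2) * partial j a (partial j a (\<lambda>z. K z y')) y"
proof -
  have D: "partial j a (\<lambda>z. covariant_partial c r j a K z y') y =
      (\<i> * of_real c / 2) * (K y y' + of_real (y j $ a) * partial j a (\<lambda>z. K z y') y)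
           + of_real r * partial j a (partial j a (\<lambda>z. K z y')) y"
    by (rule partialI(2), rule has_vector_derivative_covariant_partial_shift) (use assms in auto)
  show ?thesis
    unfolding covariant_partial_def[of c r j a "covariant_partial c r j a K"] D covariant_partial_def[of c r j a K y y']
    by (simp add: field_simps power2_eq_square)
qed

text \<open>\<open>lens\<close> reads its kernel at a single pair of points, so identities known
  only for a frozen \<open>rescale r x'\<close> can be used under it.\<close>

lemma lens_cong:
  "K (rescale r x) (rescale r x') = L (rescale r x) (rescale r x') \<Longrightarrow>
     lens c k r K x x' = lens c k r L x x'"
  by (simp add: lens_def)

text \<open>An equality of functions rather than of values, so that the rule can be applied again to
  its own right-hand side for the second derivative.\<close>

lemma partial_lens:
  assumes "j \<in> {1..k}" "\<And>y. has_partial j a (\<lambda>z. K z (rescale r x')) y"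
  shows "partial j a (\<lambda>y. lens c k r K y x') = (\<lambda>y. lens c k r (covariant_partial c r j a K) y x')"
proof
  fix y
  show "partial j a (\<lambda>y. lens c k r K y x') y = lens c k r (covariant_partial c r j a K) y x'"
    by (rule partialI(2)) (use has_vector_derivative_lens_shift assms in blast)
qed

lemma has_partial_covariant_partial:
  assumes "\<And>y. has_partial j a (\<lambda>z. K z y') y"
    and "has_partial j a (partial j a (\<lambda>z. K z y')) y"
  shows "has_partial j a (\<lambda>z. covariant_partial c r j a K z y') y"
  by (rule partialI(1), rule has_vector_derivative_covariant_partial_shift) (use assms in auto)

lemma has_partial_lens:
  assumes "j \<in> {1..k}" "\<And>y. has_partial j a (\<lambda>z. K z (rescale r x')) y"
  shows "has_partial j a (\<lambda>y. lens c k r K y x') y"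
  by (rule partialI(1)) (use has_vector_derivative_lens_shift assms in blast)

lemma partial_partial_lens:
  assumes "j \<in> {1..k}" "\<And>y. has_partial j a (\<lambda>z. K z (rescale r x')) y"
    and "\<And>y. has_partial j a (partial j a (\<lambda>z. K z (rescale r x'))) y"
  shows "partial j a (partial j a (\<lambda>y. lens c k r K y x')) =
      (\<lambda>y. lens c k r (covariant_partial c r j a (covariant_partial c r j a K)) y x')"
    and "has_partial j a (partial j a (\<lambda>y. lens c k r K y x')) y"
proof -
  have *: "has_partial j a (\<lambda>z. covariant_partial c r j a K z (rescale r x')) y" for y
    using assms by (intro has_partial_covariant_partial) auto
  have eq: "partial j a (\<lambda>y. lens c k r K y x') = (\<lambda>y. lens c k r (covariant_partial c r j a K) y x')"
    using assms by (intro partial_lens) auto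
  show "partial j a (partial j a (\<lambda>y. lens c k r K y x')) =
      (\<lambda>y. lens c k r (covariant_partial c r j a (covariant_partial c r j a K)) y x')"
    unfolding eq using assms(1) * by (intro partial_lens) auto
  show "has_partial j a (partial j a (\<lambda>y. lens c k r K y x')) y"
    unfolding eq using assms(1) * by (intro has_partial_lens) auto
qed

text \<open>Summation of the squared operators over all \<open>CARD('d) * k\<close> coordinates: the
  squares build the norm, the cross terms build \<open>radial\<close>, and each coordinate
  contributes one commutator \<open>\<i> * c * r / 2\<close>.\<close>

lemma sum_particle_laplacian_lens:
  fixes K :: "('d::finite) kernel"
  assumes "\<And>j a y. j \<in> {1..k} \<Longrightarrow> has_partial j a (\<lambda>z. K z (rescale r x')) y"
    and "\<And>j a y. j \<in> {1..k} \<Longrightarrow> has_partial j a (partial j a (\<lambda>z. K z (rescale r x'))) y"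
  shows "(\<Sum>j=1..k. particle_laplacian j (\<lambda>y. lens c k r K y x') x) =
    lens c k r (\<lambda>y y'. - of_real (c\<^sup>2 / 4 * config_norm_sq k y) * K y y'
      + \<i> * of_real (c * r) * radial k (\<lambda>z. K z y') y
      + \<i> * of_real (c * r * real (CARD('d) * k)) / 2 * K y y'
      + of_real (r\<^sup>2) * (\<Sum>j=1..k. particle_laplacian j (\<lambda>z. K z y') y)) x x'"
proof -
  let ?y = "rescale r x" and ?y' = "rescale r x'"
  have "(\<Sum>j=1..k. particle_laplacian j (\<lambda>y. lens c k r K y x') x) =
     (\<Sum>j=1..k. \<Sum>a\<in>UNIV. lens c k r (covariant_partial c r j a (covariant_partial c r j a K)) x x')"
    unfolding particle_laplacian_def
    by (intro sum.cong refl) (simp add: partial_partial_lens(1) assms)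
  also have "\<dots> = lens c k r (\<lambda>y y'. \<Sum>j=1..k. \<Sum>a\<in>UNIV. covariant_partial c r j a (covariant_partial c r j a K) y y') x x'"
    by (simp only: lens_sum)
  also have "\<dots> = lens c k r (\<lambda>y y'. - of_real (c\<^sup>2 / 4 * config_norm_sq k y) * K y y'
      + \<i> * of_real (c * r) * radial k (\<lambda>z. K z y') y
      + \<i> * of_real (c * r * real (CARD('d) * k)) / 2 * K y y'
      + of_real (r\<^sup>2) * (\<Sum>j=1..k. particle_laplacian j (\<lambda>z. K z y') y)) x x'"
  proof (rule lens_cong)
    have "(\<Sum>j=1..k. \<Sum>a\<in>UNIV. covariant_partial c r j a (covariant_partial c r j a K) ?y ?y') =
      (\<Sum>j=1..k. \<Sum>a\<in>(UNIV::'d set). - of_real (c\<^sup>2 / 4 * (?y j $ a)\<^sup>2) * K ?y ?y'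
       + \<i> * of_real (c * r) * (of_real (?y j $ a) * partial j a (\<lambda>z. K z ?y') ?y)
       + \<i> * of_real (c * r) / 2 * K ?y ?y'
       + of_real (r\<^sup>2) * partial j a (partial j a (\<lambda>z. K z ?y')) ?y)"
      by (intro sum.cong refl covariant_partial_twice assms) auto
    also have "\<dots> = - of_real (c\<^sup>2 / 4 * config_norm_sq k ?y) * K ?y ?y'
      + \<i> * of_real (c * r) * radial k (\<lambda>z. K z ?y') ?y
      + \<i> * of_real (c * r * real (CARD('d) * k)) / 2 * K ?y ?y'
      + of_real (r\<^sup>2) * (\<Sum>j=1..k. particle_laplacian j (\<lambda>z. K z ?y') ?y)"
      unfolding config_norm_sq_def norm_sq_eq_sum radial_def particle_laplacian_def
        sum.distrib sum_distrib_left of_real_sum sum_negf[symmetric] sum_distrib_right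
      by simp
    finally show "(\<Sum>j=1..k. \<Sum>a\<in>UNIV. covariant_partial c r j a (covariant_partial c r j a K) ?y ?y') =
      - of_real (c\<^sup>2 / 4 * config_norm_sq k ?y) * K ?y ?y'
      + \<i> * of_real (c * r) * radial k (\<lambda>z. K z ?y') ?y
      + \<i> * of_real (c * r * real (CARD('d) * k)) / 2 * K ?y ?y'
      + of_real (r\<^sup>2) * (\<Sum>j=1..k. particle_laplacian j (\<lambda>z. K z ?y') ?y)" .
  qed
  finally show ?thesis .
qed

section \<open>The chain rule along the moving frame\<close>

lemma regular_kernelD:
  assumes "regular_kernel k T g" "t \<in> T"
  shows "kernel_of k (g t)"
    and "j \<in> {1..k} \<Longrightarrow> has_partial j a (\<lambda>y. g t y x') x"
    and "j \<in> {1..k} \<Longrightarrow> has_partial j a (partial j a (\<lambda>y. g t y x')) x"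
    and "j \<in> {1..k} \<Longrightarrow> has_partial j a (\<lambda>y'. g t x y') x'"
    and "j \<in> {1..k} \<Longrightarrow> has_partial j a (partial j a (\<lambda>y'. g t x y')) x'"
    and "((\<lambda>s. g s x x') has_vector_derivative vector_derivative (\<lambda>s. g s x x') (at t)) (at t)"
  using assms by (auto simp: regular_kernel_def space_regular_def time_regular_def
      vector_derivative_works[symmetric])

lemma regular_kernel_continuousD:
  assumes "regular_kernel k T g"
  shows "jointly_continuous T g"
    and "jointly_continuous T (\<lambda>t x x'. vector_derivative (\<lambda>s. g s x x') (at t))"
    and "j \<in> {1..k} \<Longrightarrow> jointly_continuous T (\<lambda>t x x'. partial j a (\<lambda>y. g t y x') x)"
    and "j \<in> {1..k} \<Longrightarrow> jointly_continuous T (\<lambda>t x x'. partial j a (\<lambda>y'. g t x y') x')"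
proof -
  show "jointly_continuous T g"
    and "jointly_continuous T (\<lambda>t x x'. vector_derivative (\<lambda>s. g s x x') (at t))"
    and "j \<in> {1..k} \<Longrightarrow> jointly_continuous T (\<lambda>t x x'. partial j a (\<lambda>y. g t y x') x)"
    using assms by (auto simp: regular_kernel_def space_regular_def time_regular_def)
  show "jointly_continuous T (\<lambda>t x x'. partial j a (\<lambda>y'. g t x y') x')" if "j \<in> {1..k}"
    by (rule jointly_continuous_swap[of T "\<lambda>t x x'. partial j a (\<lambda>y. g t x' y) x"])
      (use assms that in \<open>auto simp: regular_kernel_def space_regular_def\<close>)
qed

text \<open>Three dependences on \<open>s\<close> are added one after the other: the dilation of
  \<open>x\<close>, that of \<open>x'\<close>, and the inner time. Each of the last two has a
  jointly continuous derivative, as the two-variable rule requires of the variable being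
  added.\<close>

lemma has_vector_derivative_moving_frame:
  fixes g :: "real \<Rightarrow> ('d::finite) kernel" and x x' :: "'d config"
  assumes g: "regular_kernel k T g" and T: "open T" "\<theta> t \<in> T"
    and r: "(r has_vector_derivative r') (at t)"
    and \<theta>: "(\<theta> has_vector_derivative \<theta>') (at t)"
  defines "X \<equiv> \<lambda>r. \<Sum>j=1..k. \<Sum>a\<in>UNIV. of_real (x j $ a) *
      partial j a (\<lambda>y. g (\<theta> t) y (rescale r x')) (rescale r x)"
    and "X' \<equiv> \<lambda>r. \<Sum>j=1..k. \<Sum>a\<in>UNIV. of_real (x' j $ a) *
      partial j a (g (\<theta> t) (rescale r x)) (rescale r x')"
  shows "((\<lambda>s. g (\<theta> s) (rescale (r s) x) (rescale (r s) x')) has_vector_derivative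
      r' *\<^sub>R (X (r t) + X' (r t)) +
      \<theta>' *\<^sub>R vector_derivative (\<lambda>s. g s (rescale (r t) x) (rescale (r t) x')) (at (\<theta> t))) (at t)"
proof -
  note cont = regular_kernel_continuousD[OF g]
  note reg = regular_kernelD[OF g]
  have kern: "kernel_of k (g (\<theta> t))" using reg(1) T by blast
  \<comment> \<open>With the inner time frozen, the two dilation parameters are treated as
    independent and then set equal.\<close>
  have "((\<lambda>s. g (\<theta> t) (rescale s x) (rescale s x')) has_vector_derivative
      1 *\<^sub>R X (r t) + 1 *\<^sub>R X' (r t)) (at (r t))"
    unfolding X'_def
  proof (rule has_vector_derivative_two_variables
      [where f = "\<lambda>s s'. g (\<theta> t) (rescale s x) (rescale s' x')" and u = "\<lambda>s. s" and v = "\<lambda>s. s"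
        and t = "r t" and A = "X (r t)" and Y = UNIV
        and B = "\<lambda>s s'. \<Sum>j=1..k. \<Sum>a\<in>UNIV. of_real (x' j $ a) *
      partial j a (g (\<theta> t) (rescale s x)) (rescale s' x')"])
    show "((\<lambda>s. g (\<theta> t) (rescale s x) (rescale (r t) x')) has_vector_derivative X (r t)) (at (r t))"
      unfolding X_def
    proof (rule has_vector_derivative_rescale)
      show "g (\<theta> t) y (rescale (r t) x') = g (\<theta> t) z (rescale (r t) x')"
        if "\<And>j. j \<in> {1..k} \<Longrightarrow> y j = z j" for y z
        using kern that by (simp add: kernel_of_def)
      show "continuous_on UNIV (partial j a (\<lambda>y. g (\<theta> t) y (rescale (r t) x')))"
        if "j \<in> {1..k}" for j a
        by (rule jointly_continuousD[OF cont(3)[OF that]])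
          (use T in \<open>auto intro: continuous_on_const continuous_on_id\<close>)
    qed (use reg(2) T in auto)
    show "((\<lambda>s'. g (\<theta> t) (rescale s x) (rescale s' x')) has_vector_derivative
        (\<Sum>j=1..k. \<Sum>a\<in>UNIV. of_real (x' j $ a) *
          partial j a (g (\<theta> t) (rescale s x)) (rescale s' x'))) (at s')" for s s'
    proof (rule has_vector_derivative_rescale)
      show "g (\<theta> t) (rescale s x) y = g (\<theta> t) (rescale s x) z"
        if "\<And>j. j \<in> {1..k} \<Longrightarrow> y j = z j" for y z
        using kern that by (simp add: kernel_of_def)
      show "continuous_on UNIV (partial j a (g (\<theta> t) (rescale s x)))"
        if "j \<in> {1..k}" for j a
        by (rule jointly_continuousD[OF cont(4)[OF that]])
          (use T in \<open>auto intro: continuous_on_const continuous_on_id\<close>)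
    qed (use reg(4) T in auto)
    have "continuous_on (UNIV \<times> UNIV) (\<lambda>z. partial j a (g (\<theta> t) (rescale (fst z) x)) (rescale (snd z) x'))"
      if "j \<in> {1..k}" for j a
      by (rule jointly_continuousD[OF cont(4)[OF that]])
        (use T in \<open>auto intro!: continuous_on_rescale continuous_on_fst continuous_on_snd
          continuous_on_const continuous_on_id\<close>)
    then show "continuous_on (UNIV \<times> UNIV) (\<lambda>(s, s'). \<Sum>j=1..k. \<Sum>a\<in>UNIV. of_real (x' j $ a) *
          partial j a (g (\<theta> t) (rescale s x)) (rescale s' x'))"
      unfolding case_prod_beta'
      by (intro continuous_on_sum continuous_on_mult continuous_on_const)
  qed (auto intro!: derivative_eq_intros)
  then have "((\<lambda>s. g (\<theta> t) (rescale s x) (rescale s x')) has_vector_derivative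
      X (r t) + X' (r t)) (at (r t))"
    by simp
  \<comment> \<open>The inner time is added last, with \<open>Y = T\<close>, since the time
    derivative is controlled only on \<open>T\<close>.\<close>
  then show ?thesis
  proof (rule has_vector_derivative_two_variables
      [where f = "\<lambda>s \<tau>. g \<tau> (rescale s x) (rescale s x')" and u = r and v = \<theta> and Y = T
        and B = "\<lambda>s \<tau>. vector_derivative (\<lambda>\<tau>. g \<tau> (rescale s x) (rescale s x')) (at \<tau>)"])
    show "((\<lambda>\<tau>. g \<tau> (rescale s x) (rescale s x')) has_vector_derivative
        vector_derivative (\<lambda>\<tau>. g \<tau> (rescale s x) (rescale s x')) (at \<tau>)) (at \<tau>)"
      if "\<tau> \<in> T" for s \<tau>
      using reg(6) that by blast
    show "continuous_on (UNIV \<times> T)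
        (\<lambda>(s, \<tau>). vector_derivative (\<lambda>\<tau>. g \<tau> (rescale s x) (rescale s x')) (at \<tau>))"
      unfolding case_prod_beta'
      by (rule jointly_continuousD[OF cont(2)])
        (auto intro!: continuous_on_rescale continuous_on_fst continuous_on_snd
          continuous_on_const continuous_on_id)
  qed (use T r \<theta> in auto)
qed

section \<open>The interaction term\<close>

lemma continuous_on_kernel:
  assumes "continuous_on UNIV (\<lambda>(x, x'). K x x')" "continuous_on S f" "continuous_on S f'"
  shows "continuous_on S (\<lambda>z. K (f z) (f' z))"
  using continuous_on_compose2[OF assms(1) continuous_on_Pair[OF assms(2,3)]] by simp

text \<open>A finite product of point masses is a point mass, so both integrals are evaluations;
  continuity of \<open>K\<close> provides the measurability for this.\<close>

lemma delta_contraction_eq: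
  fixes K :: "('d::finite) kernel"
  assumes K: "continuous_on UNIV (\<lambda>(x, x'). K x x')"
  shows "delta_contraction k q a K x x' =
     K (merge {1..k} {k+1..k+q} (x, \<lambda>_. a)) (merge {1..k} {k+1..k+q} (x', \<lambda>_. a))"
proof -
  let ?J = "{k+1..k+q}"
  let ?m = "\<lambda>x y. merge {1..k} ?J (x, y) :: 'd config"
  let ?P = "\<Pi>\<^sub>M l\<in>?J. (borel :: (real ^ 'd) measure)"
  \<comment> \<open>Points of a product space are extensional, so the mass sits at the restricted
    constant. \<open>merge\<close> ignores values outside \<open>?J\<close>, and the restriction
    disappears afterwards.\<close>
  have delta: "delta_measure ?J a = return ?P (restrict (\<lambda>_. a) ?J)"
    unfolding delta_measure_def by (rule PiM_return) auto
  have [simp]: "?m x (restrict (\<lambda>_. a) ?J) = ?m x (\<lambda>_. a)" for x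
    by (auto simp: merge_def)
  have "(\<lambda>y. ?m x y) \<in> ?P \<rightarrow>\<^sub>M borel" for x
  proof (rule measurable_coordinatewise_then_product)
    fix i show "(\<lambda>y. ?m x y i) \<in> borel_measurable ?P"
      by (cases "i \<in> {1..k}"; cases "i \<in> ?J") (auto simp: merge_def)
  qed
  then have meas: "(\<lambda>y. f (?m x y)) \<in> borel_measurable ?P"
    if "continuous_on UNIV f" for x and f :: "'d config \<Rightarrow> complex"
    using borel_measurable_continuous_onI[OF that] measurable_compose by blast
  have eval: "(LINT y|delta_measure ?J a. f (?m x y)) = f (?m x (\<lambda>_. a))"
    if "continuous_on UNIV f" for x and f :: "'d config \<Rightarrow> complex"
    unfolding delta using meas[OF that]
    by (subst integral_return) (auto simp: space_PiM)
  have "continuous_on UNIV (\<lambda>y. K u y)" "continuous_on UNIV (\<lambda>y. K y u)" for u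
    by (intro continuous_on_kernel[OF K] continuous_on_id continuous_on_const)+
  then have "(LINT y'|delta_measure ?J a. K u (?m x' y')) = K u (?m x' (\<lambda>_. a))"
    and "(LINT y|delta_measure ?J a. K (?m x y) u) = K (?m x (\<lambda>_. a)) u" for u
    using eval[of "K u" x'] eval[of "\<lambda>y. K y u" x] by blast+
  then show ?thesis
    unfolding delta_contraction_def by (simp only:)
qed

lemma config_norm_sq_merge:
  "config_norm_sq (k + q) (merge {1..k} {k+1..k+q} (x, \<lambda>_. a)) =
     config_norm_sq k x + real q * (norm a)\<^sup>2"
proof -
  have "{1..k+q} = {1..k} \<union> {k+1..k+q}" by auto
  then show ?thesis
    by (simp add: config_norm_sq_def merge_def sum.union_disjoint)
qed

text \<open>The contracted particles sit at the same point \<open>a\<close> in both arguments, so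
  their \<open>real q * (norm a)\<^sup>2\<close> cancels in the phase. The amplitude keeps
  \<open>r\<close> to the power \<open>CARD('d) * q\<close>, and the dilation moves the contraction
  point to \<open>r *\<^sub>R a\<close>.\<close>

lemma delta_contraction_lens:
  fixes K :: "('d::finite) kernel"
  assumes cont: "continuous_on UNIV (\<lambda>(x, x'). K x x')" and K: "kernel_of (k + q) K"
  shows "delta_contraction k q a (lens c (k + q) r K) x x' =
     of_real (r ^ (CARD('d) * q)) * lens c k r (delta_contraction k q (r *\<^sub>R a) K) x x'"
proof -
  let ?m = "\<lambda>x a. merge {1..k} {k+1..k+q} (x, \<lambda>_. a)"
  have "continuous_on UNIV (\<lambda>(x, x'). lens c (k + q) r K x x')"
  proof -
    have "continuous_on UNIV (\<lambda>z. K (rescale r (fst z)) (rescale r (snd z)))"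
      by (intro continuous_on_kernel[OF cont] continuous_on_rescale continuous_on_const
          continuous_on_fst continuous_on_snd continuous_on_id)
    moreover have "continuous_on UNIV (\<lambda>z. config_norm_sq (k + q) (fst z) :: real)"
      "continuous_on UNIV (\<lambda>z. config_norm_sq (k + q) (snd z) :: real)"
      by (intro continuous_on_config_norm_sq continuous_on_fst continuous_on_snd continuous_on_id)+
    ultimately show ?thesis
      unfolding lens_def case_prod_beta'
      by (intro continuous_on_mult continuous_on_exp continuous_on_of_real continuous_on_const
          continuous_on_diff continuous_on_divide) auto
  qed
  then have "delta_contraction k q a (lens c (k + q) r K) x x' =
      lens c (k + q) r K (?m x a) (?m x' a)"
    by (rule delta_contraction_eq)
  \<comment> \<open>Beyond index \<open>k + q\<close> one configuration is \<open>r\<close> times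
    \<open>undefined\<close> and the other is \<open>undefined\<close>; \<open>kernel_of\<close>
    makes this invisible to \<open>K\<close>.\<close>
  moreover have "K (rescale r (?m x a)) (rescale r (?m x' a)) =
      K (?m (rescale r x) (r *\<^sub>R a)) (?m (rescale r x') (r *\<^sub>R a))"
    using K by (auto simp: kernel_of_def merge_def)
  ultimately show ?thesis
    by (simp add: lens_def delta_contraction_eq[OF cont] config_norm_sq_merge[of k q, simplified]
        power_add distrib_left)
qed

text \<open>The contraction point \<open>r *\<^sub>R x j\<close> is the \<open>j\<close>-th particle
  of the dilated configuration, so the contractions at \<open>x j\<close> and \<open>x' j\<close>
  reassemble to the interaction there.\<close>

lemma gp_interaction_lens:
  fixes K :: "('d::finite) kernel"
  assumes "continuous_on UNIV (\<lambda>(x, x'). K x x')" and "kernel_of (k + p div 2) K"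
  shows "gp_interaction p k (lens c (k + p div 2) r K) x x' =
     of_real (r ^ (CARD('d) * (p div 2))) * lens c k r (gp_interaction p k K) x x'"
  unfolding gp_interaction_def delta_contraction_lens[OF assms]
  by (simp add: lens_def sum_distrib_left right_diff_distrib mult_ac)

section \<open>The time set and spatial regularity of the transformed family\<close>

text \<open>The time set of the final claim. The first conjunct excludes the pole, where
  \<open>t / 0 = 0\<close> might lie in \<open>T\<close>.\<close>

definition lens_times :: "real \<Rightarrow> real set \<Rightarrow> real set" where
  "lens_times b T = {t. 1 + b * t \<noteq> 0 \<and> t / (1 + b * t) \<in> T}"

lemma lens_timesD:
  assumes "t \<in> lens_times b T"
  shows "1 + b * t \<noteq> 0" "t * inverse (1 + b * t) \<in> T"
  using assms by (auto simp: lens_times_def divide_inverse)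

lemma continuous_on_lens_times:
  "continuous_on (lens_times b T) (\<lambda>t. inverse (1 + b * t))"
  "continuous_on (lens_times b T) (\<lambda>t. t * inverse (1 + b * t))"
  by (auto intro!: continuous_intros dest: lens_timesD)

lemma jointly_continuous_cong:
  "(\<And>t. t \<in> T \<Longrightarrow> f t = g t) \<Longrightarrow> jointly_continuous T f \<longleftrightarrow> jointly_continuous T g"
  unfolding jointly_continuous_iff by (rule continuous_on_cong) auto

lemma jointly_continuous_rescale:
  assumes "jointly_continuous T g"
  shows "jointly_continuous (lens_times b T) (\<lambda>t x x'. g (t * inverse (1 + b * t))
     (rescale (inverse (1 + b * t)) x) (rescale (inverse (1 + b * t)) x'))"
proof -
  let ?S = "lens_times b T \<times> UNIV \<times> UNIV :: (real \<times> 'a config \<times> 'a config) set"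
  have fst: "continuous_on ?S (\<lambda>z. f (fst z))" if "continuous_on (lens_times b T) f" for f :: "real \<Rightarrow> real"
    by (rule continuous_on_compose2[OF that]) (auto intro: continuous_on_fst continuous_on_id)
  note r = fst[OF continuous_on_lens_times(1)] and \<theta> = fst[OF continuous_on_lens_times(2)]
  show ?thesis
    unfolding jointly_continuous_iff
    by (rule jointly_continuousD[OF assms \<theta>])
      (intro continuous_on_rescale r continuous_on_fst continuous_on_snd continuous_on_id
        | auto dest: lens_timesD)+
qed

lemma jointly_continuous_config_norm_sq:
  "jointly_continuous T (\<lambda>t x x'. of_real (config_norm_sq k x))"
  unfolding jointly_continuous_iff
  by (intro continuous_on_of_real continuous_on_config_norm_sq continuous_on_fst continuous_on_snd
      continuous_on_id)

lemma jointly_continuous_minus: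
  "jointly_continuous T f \<Longrightarrow> jointly_continuous T g \<Longrightarrow>
     jointly_continuous T (\<lambda>t x x'. f t x x' - g t x x')"
  unfolding jointly_continuous_iff by (rule continuous_on_diff)

lemma jointly_continuous_uminus:
  "jointly_continuous T f \<Longrightarrow> jointly_continuous T (\<lambda>t x x'. - f t x x')"
  unfolding jointly_continuous_iff by (rule continuous_on_minus)

lemma jointly_continuous_const: "jointly_continuous T (\<lambda>t x x'. z)"
  unfolding jointly_continuous_iff by (rule continuous_on_const)

lemma jointly_continuous_exp:
  "jointly_continuous T f \<Longrightarrow> jointly_continuous T (\<lambda>t x x'. exp (f t x x'))"
  unfolding jointly_continuous_iff by (rule continuous_on_exp)

lemmas jointly_continuous_intros =
  jointly_continuous_add jointly_continuous_minus jointly_continuous_uminus jointly_continuous_mult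
  jointly_continuous_const

text \<open>The premise concerns the dilated kernel, the form supplied by
  \<open>jointly_continuous_rescale\<close>; it splits along sums and products in
  \<open>G\<close>.\<close>

lemma jointly_continuous_lens:
  assumes "jointly_continuous (lens_times b T) (\<lambda>t x x'. G t
     (rescale (inverse (1 + b * t)) x) (rescale (inverse (1 + b * t)) x'))"
  shows "jointly_continuous (lens_times b T) (\<lambda>t. lens c k (inverse (1 + b * t)) (G t))"
proof -
  have "jointly_continuous (lens_times b T) (\<lambda>t x x'. of_real (inverse (1 + b * t)) :: complex)"
    by (intro jointly_continuous_time continuous_on_of_real continuous_on_lens_times)
  moreover have "jointly_continuous (lens_times b T)
      (\<lambda>t x x'. of_real (inverse (1 + b * t) ^ (CARD('a) * k)) :: complex)"
    by (intro jointly_continuous_time continuous_on_of_real continuous_on_power continuous_on_lens_times)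
  ultimately show ?thesis
    unfolding lens_def of_real_mult of_real_diff of_real_divide divide_inverse[of _ "of_real 4"]
    by (intro jointly_continuous_intros jointly_continuous_exp jointly_continuous_config_norm_sq assms
        jointly_continuous_swap[OF jointly_continuous_config_norm_sq])
qed

lemma jointly_continuous_inverse_time:
  "jointly_continuous (lens_times b T) (\<lambda>t x x'. of_real (inverse (1 + b * t)))"
  by (intro jointly_continuous_time continuous_on_of_real continuous_on_lens_times)

text \<open>The derivatives are again lenses of explicit kernels built from \<open>g\<close> and its
  derivatives, so continuity can be read off. A free \<open>c\<close> lets the same lemma serve the
  primed variables.\<close>

lemma space_regular_lens:
  fixes g :: "real \<Rightarrow> ('d::finite) kernel"
  assumes g: "space_regular k T g" and c: "jointly_continuous T g"
  shows "space_regular k (lens_times b T)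
     (\<lambda>t. lens c k (inverse (1 + b * t)) (g (t * inverse (1 + b * t))))"
  unfolding space_regular_def
proof (intro ballI allI)
  fix j :: nat and a :: 'd
  assume j: "j \<in> {1..k}"
  let ?r = "\<lambda>t. inverse (1 + b * t)"
  let ?\<theta> = "\<lambda>t. t * inverse (1 + b * t)"
  let ?L = "\<lambda>t. lens c k (?r t) (g (?\<theta> t))"
  have p: "has_partial j a (\<lambda>z. g (?\<theta> t) z x') y" "has_partial j a (partial j a (\<lambda>z. g (?\<theta> t) z x')) y"
    if "t \<in> lens_times b T" for t x' y
    using g lens_timesD(2)[OF that] j by (auto simp: space_regular_def)
  have cp: "jointly_continuous T (\<lambda>t x x'. partial j a (\<lambda>y. g t y x') x)"
    "jointly_continuous T (\<lambda>t x x'. partial j a (partial j a (\<lambda>y. g t y x')) x)"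
    using g j by (auto simp: space_regular_def)
  note cr = jointly_continuous_rescale[where b = b, OF c] jointly_continuous_rescale[where b = b, OF cp(1)]
    jointly_continuous_rescale[where b = b, OF cp(2)]
    jointly_continuous_rescale[where b = b, OF jointly_continuous_component[of T j a]]
  have 1: "partial j a (\<lambda>y. ?L t y x') = (\<lambda>y. lens c k (?r t) (covariant_partial c (?r t) j a (g (?\<theta> t))) y x')"
    if "t \<in> lens_times b T" for t x'
    using j p[OF that] by (intro partial_lens) auto
  \<comment> \<open>Squares are written as products because the continuity rules cover sums and
    products.\<close>
  have 2: "partial j a (partial j a (\<lambda>y. ?L t y x')) =
      (\<lambda>y. lens c k (?r t) (\<lambda>y y'. - of_real (c\<^sup>2 / 4) * (of_real (y j $ a) * of_real (y j $ a)) * g (?\<theta> t) y y'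
     + \<i> * of_real c * of_real (?r t) * (of_real (y j $ a) * partial j a (\<lambda>z. g (?\<theta> t) z y') y)
     + \<i> * of_real c * of_real (?r t) / 2 * g (?\<theta> t) y y'
     + of_real (?r t) * of_real (?r t) * partial j a (partial j a (\<lambda>z. g (?\<theta> t) z y')) y) y x')"
    if t: "t \<in> lens_times b T" for t x'
  proof -
    have "partial j a (partial j a (\<lambda>y. ?L t y x')) =
        (\<lambda>y. lens c k (?r t) (covariant_partial c (?r t) j a (covariant_partial c (?r t) j a (g (?\<theta> t)))) y x')"
      using j p[OF t] by (intro partial_partial_lens) auto
    also have "\<dots> = (\<lambda>y. lens c k (?r t) (\<lambda>y y'. - of_real (c\<^sup>2 / 4) * (of_real (y j $ a) * of_real (y j $ a)) * g (?\<theta> t) y y'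
     + \<i> * of_real c * of_real (?r t) * (of_real (y j $ a) * partial j a (\<lambda>z. g (?\<theta> t) z y') y)
     + \<i> * of_real c * of_real (?r t) / 2 * g (?\<theta> t) y y'
     + of_real (?r t) * of_real (?r t) * partial j a (partial j a (\<lambda>z. g (?\<theta> t) z y')) y) y x')"
      using p[OF t] by (intro ext lens_cong, subst covariant_partial_twice)
        (auto simp: power2_eq_square simp del: rescale_apply)
    finally show ?thesis .
  qed
  have "jointly_continuous (lens_times b T) (\<lambda>t x x'. partial j a (\<lambda>y. ?L t y x') x)
    \<longleftrightarrow> jointly_continuous (lens_times b T) (\<lambda>t. lens c k (?r t) (covariant_partial c (?r t) j a (g (?\<theta> t))))"
    by (rule jointly_continuous_cong) (simp only: 1)
  moreover have "jointly_continuous (lens_times b T) (\<lambda>t. lens c k (?r t) (covariant_partial c (?r t) j a (g (?\<theta> t))))"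
    unfolding covariant_partial_def
    by (intro jointly_continuous_lens jointly_continuous_intros jointly_continuous_inverse_time cr)
  moreover have "jointly_continuous (lens_times b T) (\<lambda>t x x'. partial j a (partial j a (\<lambda>y. ?L t y x')) x)
    \<longleftrightarrow> jointly_continuous (lens_times b T) (\<lambda>t. lens c k (?r t) (\<lambda>y y'. - of_real (c\<^sup>2 / 4) * (of_real (y j $ a) * of_real (y j $ a)) * g (?\<theta> t) y y'
     + \<i> * of_real c * of_real (?r t) * (of_real (y j $ a) * partial j a (\<lambda>z. g (?\<theta> t) z y') y)
     + \<i> * of_real c * of_real (?r t) / 2 * g (?\<theta> t) y y'
     + of_real (?r t) * of_real (?r t) * partial j a (partial j a (\<lambda>z. g (?\<theta> t) z y')) y))"
    by (rule jointly_continuous_cong) (simp only: 2)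
  moreover have "jointly_continuous (lens_times b T) (\<lambda>t. lens c k (?r t) (\<lambda>y y'. - of_real (c\<^sup>2 / 4) * (of_real (y j $ a) * of_real (y j $ a)) * g (?\<theta> t) y y'
     + \<i> * of_real c * of_real (?r t) * (of_real (y j $ a) * partial j a (\<lambda>z. g (?\<theta> t) z y') y)
     + \<i> * of_real c * of_real (?r t) / 2 * g (?\<theta> t) y y'
     + of_real (?r t) * of_real (?r t) * partial j a (partial j a (\<lambda>z. g (?\<theta> t) z y')) y))"
    unfolding divide_inverse[of _ "2 :: complex"]
    by (intro jointly_continuous_lens jointly_continuous_intros jointly_continuous_inverse_time cr)
  moreover have "has_partial j a (\<lambda>y. ?L t y x') x" "has_partial j a (partial j a (\<lambda>y. ?L t y x')) x"
    if "t \<in> lens_times b T" for t x x'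
    using has_partial_lens[OF j, of a "g (?\<theta> t)"] partial_partial_lens(2)[OF j, of a "g (?\<theta> t)"] p[OF that]
    by blast+
  ultimately show "(\<forall>t\<in>lens_times b T. \<forall>x x'. has_partial j a (\<lambda>y. ?L t y x') x \<and>
        has_partial j a (partial j a (\<lambda>y. ?L t y x')) x) \<and>
     jointly_continuous (lens_times b T) (\<lambda>t x x'. partial j a (\<lambda>y. ?L t y x') x) \<and>
     jointly_continuous (lens_times b T) (\<lambda>t x x'. partial j a (partial j a (\<lambda>y. ?L t y x')) x)"
    by blast
qed

section \<open>The time derivative and regularity of the transformed family\<close>

text \<open>Product rule for amplitude, phase and moving kernel, using
  \<open>r' = - b * r\<^sup>2\<close> and \<open>\<theta>' = r\<^sup>2\<close>. The factor
  \<open>r\<^sup>2\<close> from the phase turns the norms of \<open>x\<close> and \<open>x'\<close>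
  into those of the dilated points, so the result is again a lens.\<close>

lemma has_vector_derivative_lens_time:
  fixes g :: "real \<Rightarrow> ('d::finite) kernel" and x x' :: "'d config"
  assumes g: "regular_kernel k T g" and T: "open T" and t: "t \<in> lens_times b T"
    and r_def: "r = inverse (1 + b * t)" and \<theta>_def: "\<theta> = t * r"
  shows "((\<lambda>s. lens b k (inverse (1 + b * s)) (g (s * inverse (1 + b * s))) x x')
    has_vector_derivative lens b k r (\<lambda>y y'.
      - of_real (b * r * real (CARD('d) * k)) * g \<theta> y y'
      - \<i> * of_real (b\<^sup>2 / 4) * (of_real (config_norm_sq k y) - of_real (config_norm_sq k y')) * g \<theta> y y'
      - of_real (b * r) * (radial k (\<lambda>z. g \<theta> z y') y + radial k (g \<theta> y) y')
      + of_real (r\<^sup>2) * vector_derivative (\<lambda>s. g s y y') (at \<theta>)) x x') (at t)"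
proof -
  let ?r = "\<lambda>s. inverse (1 + b * s)" and ?\<theta> = "\<lambda>s. s * inverse (1 + b * s)"
  let ?n = "CARD('d) * k"
  let ?N = "config_norm_sq k x - config_norm_sq k x'"
  let ?y = "rescale r x" and ?y' = "rescale r x'"
  let ?X = "\<Sum>j=1..k. \<Sum>a\<in>UNIV. of_real (x j $ a) * partial j a (\<lambda>y. g \<theta> y ?y') ?y"
  let ?X' = "\<Sum>j=1..k. \<Sum>a\<in>UNIV. of_real (x' j $ a) * partial j a (g \<theta> ?y) ?y'"
  let ?D = "vector_derivative (\<lambda>s. g s ?y ?y') (at \<theta>)"
  let ?e = "\<lambda>s. exp (\<i> * of_real (b * ?r s * ?N / 4))"
  have nz: "1 + b * t \<noteq> 0" and \<theta>T: "\<theta> \<in> T"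
    using lens_timesD[OF t] by (auto simp: \<theta>_def r_def)
  have dr: "(?r has_real_derivative - b * r\<^sup>2) (at t)"
    using nz by (auto intro!: derivative_eq_intros simp: r_def power2_eq_square)
  \<comment> \<open>This is \<open>r * (1 + b * t) = 1\<close>; multiplied by \<open>r\<close> it
    identifies the product-rule derivative of \<open>t * r\<close> with
    \<open>r\<^sup>2\<close>.\<close>
  have "1 - b * t * r = r"
    using nz by (simp add: r_def field_simps)
  then have "r - t * b * r\<^sup>2 = r\<^sup>2"
    by (metis mult.assoc mult.commute mult.left_commute power2_eq_square right_diff_distrib' mult.right_neutral)
  then have d\<theta>: "(?\<theta> has_real_derivative r\<^sup>2) (at t)"
    using DERIV_mult[OF DERIV_ident dr, THEN DERIV_cong, of "r\<^sup>2"]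
    by (simp add: r_def[symmetric] mult_ac)
  have "((\<lambda>s. ?r s ^ ?n) has_real_derivative real ?n * (- b * r\<^sup>2) * r ^ (?n - 1)) (at t)"
    using DERIV_power[OF dr, of ?n] by (simp add: r_def mult_ac)
  \<comment> \<open>The exponent \<open>?n - 1\<close> is truncated subtraction; for
    \<open>?n = 0\<close> both sides vanish.\<close>
  moreover have "real ?n * (- b * r\<^sup>2) * r ^ (?n - 1) = - (b * r * real ?n) * r ^ ?n"
    by (cases ?n) (simp_all add: power2_eq_square)
  ultimately have "((\<lambda>s. ?r s ^ ?n) has_real_derivative - (b * r * real ?n) * r ^ ?n) (at t)"
    by (simp only:)
  then have "((\<lambda>s. of_real (?r s ^ ?n) :: complex) has_vector_derivative
      of_real (- (b * r * real ?n) * r ^ ?n)) (at t)"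
    by (rule has_vector_derivative_of_real)
  moreover have "(?e has_vector_derivative \<i> * of_real (b * (- b * r\<^sup>2) * ?N / 4) * ?e t) (at t)"
    using DERIV_cmult[OF dr, of b, THEN DERIV_cmult_right, of ?N, THEN DERIV_cdivide, of 4]
    by (rule has_vector_derivative_exp_phase)
  moreover have "((\<lambda>s. g (?\<theta> s) (rescale (?r s) x) (rescale (?r s) x')) has_vector_derivative
      (- b * r\<^sup>2) *\<^sub>R (?X + ?X') + r\<^sup>2 *\<^sub>R ?D) (at t)"
    using has_vector_derivative_moving_frame[OF g T, of ?\<theta> t ?r "- b * r\<^sup>2" "r\<^sup>2" x x'] \<theta>T dr d\<theta>
    by (simp add: has_real_derivative_iff_has_vector_derivative \<theta>_def r_def)
  ultimately have "((\<lambda>s. of_real (?r s ^ ?n) * ?e s * g (?\<theta> s) (rescale (?r s) x) (rescale (?r s) x'))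
      has_vector_derivative
      of_real (?r t ^ ?n) * ?e t * ((- b * r\<^sup>2) *\<^sub>R (?X + ?X') + r\<^sup>2 *\<^sub>R ?D) +
      (of_real (?r t ^ ?n) * (\<i> * of_real (b * (- b * r\<^sup>2) * ?N / 4) * ?e t) +
       of_real (- (b * r * real ?n) * r ^ ?n) * ?e t) * g (?\<theta> t) (rescale (?r t) x) (rescale (?r t) x')) (at t)"
    by (intro has_vector_derivative_mult)
  moreover have "of_real (?r t ^ ?n) * ?e t * ((- b * r\<^sup>2) *\<^sub>R (?X + ?X') + r\<^sup>2 *\<^sub>R ?D) +
      (of_real (?r t ^ ?n) * (\<i> * of_real (b * (- b * r\<^sup>2) * ?N / 4) * ?e t) +
       of_real (- (b * r * real ?n) * r ^ ?n) * ?e t) * g (?\<theta> t) (rescale (?r t) x) (rescale (?r t) x') =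
    lens b k r (\<lambda>y y'.
      - of_real (b * r * real ?n) * g \<theta> y y'
      - \<i> * of_real (b\<^sup>2 / 4) * (of_real (config_norm_sq k y) - of_real (config_norm_sq k y')) * g \<theta> y y'
      - of_real (b * r) * (radial k (\<lambda>z. g \<theta> z y') y + radial k (g \<theta> y) y')
      + of_real (r\<^sup>2) * vector_derivative (\<lambda>s. g s y y') (at \<theta>)) x x'"
    unfolding lens_def radial_rescale config_norm_sq_rescale scaleR_conv_of_real
      r_def[symmetric] \<theta>_def[symmetric]
    by (simp add: field_simps power2_eq_square)
  ultimately show ?thesis
    by (simp only: lens_def)
qed

lemma jointly_continuous_radial:
  assumes "\<And>j a. j \<in> {1..k} \<Longrightarrow> jointly_continuous T (\<lambda>t x x'. partial j a (\<lambda>y. g t y x') x)"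
  shows "jointly_continuous T (\<lambda>t x x'. radial k (\<lambda>y. g t y x') x)"
  unfolding radial_def
  by (intro jointly_continuous_sum jointly_continuous_mult jointly_continuous_component assms)

text \<open>Continuity of the time derivative follows from its explicit formula \<open>?G\<close>,
  and regularity in the primed variables from the unprimed case by \<open>lens_swap\<close>.\<close>

lemma regular_kernel_lens:
  fixes g :: "real \<Rightarrow> ('d::finite) kernel"
  assumes g: "regular_kernel k T g" and T: "open T"
  shows "regular_kernel k (lens_times b T)
     (\<lambda>t. lens b k (inverse (1 + b * t)) (g (t * inverse (1 + b * t))))"
proof -
  let ?r = "\<lambda>s. inverse (1 + b * s)" and ?\<theta> = "\<lambda>s. s * inverse (1 + b * s)"
  let ?n = "CARD('d) * k"
  let ?G = "\<lambda>t y y'. - of_real (b * ?r t * real ?n) * g (?\<theta> t) y y'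
      - \<i> * of_real (b\<^sup>2 / 4) * (of_real (config_norm_sq k y) - of_real (config_norm_sq k y')) * g (?\<theta> t) y y'
      - of_real (b * ?r t) * (radial k (\<lambda>z. g (?\<theta> t) z y') y + radial k (g (?\<theta> t) y) y')
      + of_real ((?r t)\<^sup>2) * vector_derivative (\<lambda>s. g s y y') (at (?\<theta> t))"
  note cont = regular_kernel_continuousD[OF g]
  have reg: "space_regular k T g" "space_regular k T (\<lambda>t x x'. g t x' x)"
    using g by (auto simp: regular_kernel_def)
  have rad: "jointly_continuous T (\<lambda>t x x'. radial k (\<lambda>y. g t y x') x)"
    "jointly_continuous T (\<lambda>t x x'. radial k (g t x) x')"
    using jointly_continuous_radial[OF cont(3)]
      jointly_continuous_swap[OF jointly_continuous_radial[of k T "\<lambda>t x x'. g t x' x"]]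
      jointly_continuous_swap[OF cont(4)]
    by blast+
  note cr = jointly_continuous_rescale[where b = b, OF cont(1)]
    jointly_continuous_rescale[where b = b, OF cont(2)]
    jointly_continuous_rescale[where b = b, OF rad(1)]
    jointly_continuous_rescale[where b = b, OF rad(2)]
    jointly_continuous_rescale[where b = b, OF jointly_continuous_config_norm_sq[of T k]]
    jointly_continuous_rescale[where b = b, OF jointly_continuous_swap[OF jointly_continuous_config_norm_sq[of T k]]]
  have "jointly_continuous (lens_times b T) (\<lambda>t. lens b k (?r t) (?G t))"
    unfolding of_real_mult of_real_power power2_eq_square[of "of_real (?r _)"]
    by (intro jointly_continuous_lens jointly_continuous_intros jointly_continuous_inverse_time cr)
  moreover have deriv: "((\<lambda>s. lens b k (?r s) (g (?\<theta> s)) x x') has_vector_derivative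
      lens b k (?r t) (?G t) x x') (at t)" if "t \<in> lens_times b T" for t x x'
    by (rule has_vector_derivative_lens_time[OF g T that refl refl])
  moreover have "jointly_continuous (lens_times b T)
      (\<lambda>t x x'. vector_derivative (\<lambda>s. lens b k (?r s) (g (?\<theta> s)) x x') (at t)) \<longleftrightarrow>
      jointly_continuous (lens_times b T) (\<lambda>t. lens b k (?r t) (?G t))"
    by (intro jointly_continuous_cong ext vector_derivative_at deriv)
  ultimately have "time_regular (lens_times b T) (\<lambda>t. lens b k (?r t) (g (?\<theta> t)))"
    unfolding time_regular_def by (meson differentiableI_vector)
  moreover have "jointly_continuous (lens_times b T) (\<lambda>t. lens b k (?r t) (g (?\<theta> t)))"
    by (intro jointly_continuous_lens cr)
  moreover have "space_regular k (lens_times b T) (\<lambda>t. lens b k (?r t) (g (?\<theta> t)))"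
    using reg(1) cont(1) by (rule space_regular_lens)
  moreover have "space_regular k (lens_times b T) (\<lambda>t x x'. lens b k (?r t) (g (?\<theta> t)) x' x)"
    unfolding lens_swap[of b]
    using reg(2) jointly_continuous_swap[OF cont(1)] by (rule space_regular_lens)
  ultimately show ?thesis
    using regular_kernelD(1)[OF g] lens_timesD(2)
    by (auto simp: regular_kernel_def intro: kernel_of_lens)
qed

section \<open>The Laplacian of the transform and the hierarchy equation\<close>

text \<open>For the primed half, \<open>c\<close> becomes \<open>- c\<close>. The norm terms are
  even in \<open>c\<close> and are subtracted, whereas the radial and dimensional terms are odd and
  add up; the two halves \<open>\<i> * c * r / 2\<close> per coordinate thus become a whole
  one.\<close>

lemma laplacian_pm_lens:
  fixes g :: "real \<Rightarrow> ('d::finite) kernel"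
  assumes "regular_kernel k T g" "t \<in> T"
  shows "laplacian_pm k (lens c k r (g t)) x x' = lens c k r (\<lambda>y y'.
     - of_real (c\<^sup>2 / 4) * (of_real (config_norm_sq k y) - of_real (config_norm_sq k y')) * g t y y'
      + \<i> * of_real (c * r) * (radial k (\<lambda>z. g t z y') y + radial k (g t y) y')
      + \<i> * of_real (c * r * real (CARD('d) * k)) * g t y y'
      + of_real (r\<^sup>2) * laplacian_pm k (g t) y y') x x'"
proof -
  have 1: "(\<Sum>j=1..k. particle_laplacian j (\<lambda>y. lens c k r (g t) y x') x) =
    lens c k r (\<lambda>y y'. - of_real (c\<^sup>2 / 4 * config_norm_sq k y) * g t y y'
      + \<i> * of_real (c * r) * radial k (\<lambda>z. g t z y') y
      + \<i> * of_real (c * r * real (CARD('d) * k)) / 2 * g t y y'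
      + of_real (r\<^sup>2) * (\<Sum>j=1..k. particle_laplacian j (\<lambda>z. g t z y') y)) x x'"
    by (rule sum_particle_laplacian_lens) (use regular_kernelD(2-5)[OF assms] in auto)
  have "(\<Sum>j=1..k. particle_laplacian j (\<lambda>y'. lens (- c) k r (\<lambda>y y'. g t y' y) y' x) x') =
    lens (- c) k r (\<lambda>y y'. - of_real ((- c)\<^sup>2 / 4 * config_norm_sq k y) * g t y' y
      + \<i> * of_real (- c * r) * radial k (\<lambda>z. g t y' z) y
      + \<i> * of_real (- c * r * real (CARD('d) * k)) / 2 * g t y' y
      + of_real (r\<^sup>2) * (\<Sum>j=1..k. particle_laplacian j (\<lambda>z. g t y' z) y)) x' x"
    by (rule sum_particle_laplacian_lens) (use regular_kernelD(2-5)[OF assms] in auto)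
  then have 2: "(\<Sum>j=1..k. particle_laplacian j (\<lambda>y'. lens c k r (g t) x y') x') =
    lens c k r (\<lambda>y y'. - of_real ((- c)\<^sup>2 / 4 * config_norm_sq k y') * g t y y'
      + \<i> * of_real (- c * r) * radial k (\<lambda>z. g t y z) y'
      + \<i> * of_real (- c * r * real (CARD('d) * k)) / 2 * g t y y'
      + of_real (r\<^sup>2) * (\<Sum>j=1..k. particle_laplacian j (\<lambda>z. g t y z) y')) x x'"
    by (simp only: lens_swap[of "- c"] minus_minus)
  show ?thesis
    unfolding laplacian_pm_def sum_subtractf 1 2 by (simp add: lens_def field_simps)
qed

theorem theorem2p10:
  fixes \<gamma> :: "nat \<Rightarrow> real \<Rightarrow> ('d::finite) kernel"
    and p :: nat and \<mu> b :: real and T :: "real set"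
  assumes "(CARD('d) = 2 \<and> p = 2) \<or> (CARD('d) = 1 \<and> p = 4)"
    and "\<mu> \<in> {1, -1}"
    and "b \<noteq> 0"
    and "open T"
    and "\<forall>k\<ge>1. \<forall>t\<in>T. marginal_density_matrix k (\<gamma> k t)"
    and "gp_solution p \<mu> T \<gamma>"
  shows "gp_solution p \<mu> {t. 1 + b * t \<noteq> 0 \<and> t / (1 + b * t) \<in> T} (pseudoconformal b \<gamma>)"
proof -
  \<comment> \<open>The critical relation \<open>d * p = 4\<close>: it makes the additional
    amplitude of the interaction equal to the \<open>r\<^sup>2\<close> of the linear part.\<close>
  have dim: "CARD('d) * (p div 2) = 2"
    using assms(1) by auto
  have reg: "regular_kernel k T (\<gamma> k)" if "k \<ge> 1" for k
    using assms(6) that by (auto simp: gp_solution_def)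
  have pc: "pseudoconformal b \<gamma> k =
      (\<lambda>t. lens b k (inverse (1 + b * t)) (\<gamma> k (t * inverse (1 + b * t))))" for k
    by (rule ext) (rule pseudoconformal_eq_lens)
  have "\<i> * vector_derivative (\<lambda>s. pseudoconformal b \<gamma> k s x x') (at t)
      + laplacian_pm k (pseudoconformal b \<gamma> k t) x x'
      - of_real \<mu> * gp_interaction p k (pseudoconformal b \<gamma> (k + p div 2) t) x x' = 0"
    if k: "k \<ge> 1" and t: "t \<in> lens_times b T" for k t x x'
  proof -
    define r where "r = inverse (1 + b * t)"
    define \<theta> where "\<theta> = t * r"
    let ?y = "rescale r x" and ?y' = "rescale r x'"
    let ?R = "\<lambda>y y'. \<i> * vector_derivative (\<lambda>s. \<gamma> k s y y') (at \<theta>) + laplacian_pm k (\<gamma> k \<theta>) y y'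
        - of_real \<mu> * gp_interaction p k (\<gamma> (k + p div 2) \<theta>) y y'"
    have \<theta>: "\<theta> \<in> T" using lens_timesD(2)[OF t] by (simp add: \<theta>_def r_def)
    have reg': "regular_kernel (k + p div 2) T (\<gamma> (k + p div 2))" using reg k by simp
    have "continuous_on UNIV (\<lambda>(y, y'). \<gamma> (k + p div 2) \<theta> y y')"
      unfolding case_prod_beta'
      by (rule jointly_continuousD[OF regular_kernel_continuousD(1)[OF reg']])
        (use \<theta> in \<open>auto intro: continuous_on_const continuous_on_fst continuous_on_snd continuous_on_id\<close>)
    then have gp: "gp_interaction p k (lens b (k + p div 2) r (\<gamma> (k + p div 2) \<theta>)) x x' =
        of_real (r\<^sup>2) * lens b k r (gp_interaction p k (\<gamma> (k + p div 2) \<theta>)) x x'"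
      using regular_kernelD(1)[OF reg' \<theta>] gp_interaction_lens dim by metis
    note vd = vector_derivative_at[OF has_vector_derivative_lens_time[OF reg[OF k] assms(4) t r_def \<theta>_def]]
    note lap = laplacian_pm_lens[OF reg[OF k] \<theta>]
    \<comment> \<open>With \<open>c = b\<close>, the norm, radial and dimensional terms of
      \<open>vd\<close>, multiplied by \<open>\<i>\<close>, are the exact negatives of those in
      \<open>lap\<close>; the remaining terms all carry \<open>r\<^sup>2\<close>.\<close>
    have "\<i> * vector_derivative (\<lambda>s. pseudoconformal b \<gamma> k s x x') (at t)
        + laplacian_pm k (pseudoconformal b \<gamma> k t) x x'
        - of_real \<mu> * gp_interaction p k (pseudoconformal b \<gamma> (k + p div 2) t) x x' =
        of_real (r\<^sup>2) * lens b k r ?R x x'"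
      unfolding pc r_def[symmetric] \<theta>_def[symmetric] vd lap gp
      by (simp add: lens_def field_simps)
    \<comment> \<open>The dilated pair is the only one at which \<open>lens\<close> evaluates
      \<open>?R\<close>, and there the equation for \<open>\<gamma>\<close> at time
      \<open>\<theta> \<in> T\<close> applies.\<close>
    also have "?R ?y ?y' = 0"
      using assms(6) k \<theta> by (auto simp: gp_solution_def)
    then have "lens b k r ?R x x' = 0"
      unfolding lens_def by simp
    finally show ?thesis by simp
  qed
  then show ?thesis
    using regular_kernel_lens[OF reg assms(4)]
    unfolding gp_solution_def lens_times_def[symmetric] by (simp add: pc)
qed

end
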